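(* Let $\vec X=(X_0,X_1)$ be an interpolation couple of compatible Banach lattices. Then: (a) Every exact partially $K$-monotone intermediate space of $\vec X$ is an exact interpolation space for positive, linear operators. (b) If (1) the couple $\vec X$ is an exact Calderón-Mityagin couple with respect to positive operators, (2) the spaces $X_0$ and $X_1$ are $\sigma$-Dedekind complete, and (3) for every pair of principal band projections $P,Q\in\mathcal L^+(\vec X)$ and every pair of contractions $T_1\in\mathcal L^+(P\vec X,Q\vec X)$, $T_2\in\mathcal L^+((I-P)\vec X,(I-Q)\vec X)$ the diagonal operator $T\in\mathcal L(\vec X)$ given by $T=QT_1P+(I-Q)T_2(I-P)$ is a contraction, then every exact interpolation space for positive, linear operators is exactly partially $K$-monotone.
   Context: Banach lattices are real. An interpolation couple $\vec X=(X_0,X_1)$ of Banach spaces is a pair of Banach spaces continuously embedded in a common Hausdorff topological vector space; $\|f\|_{X_0\cap X_1}=\|f\|_{X_0}+\|f\|_{X_1}$ and $\|f\|_{X_0+X_1}=\inf\{\|f_0\|_{X_0}+\|f_1\|_{X_1}:f_i\in X_i,\ f=f_0+f_1\}$. It is an interpolation couple of compatible Banach lattices if $X_0$, $X_1$ and $X_0+X_1$ are Banach lattices and $X_0$, $X_1$ are order ideals in $X_0+X_1$. An intermediate space is a Banach space $X$ with $X_0\cap X_1\subseteq X\subseteq X_0+X_1$ with continuous embeddings. Write $f^+=f\vee0$, $f^-=(-f)\vee0$. $K(f,t)=\inf\{\|f_0\|_{X_0}+t\|f_1\|_{X_1}: f=f_0+f_1,\ f_i\in X_i\}$ for $f\in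 X_0+X_1$, $t\in(0,\infty)$. Write $g\ll_K f$ if $K(g^+,\cdot)\le K(f^+,\cdot)$ and $K(g^-,\cdot)\le K(f^-,\cdot)$ pointwise on $(0,\infty)$. An intermediate space $X$ is exactly partially $K$-monotone if for every $f\in X$, $g\in X_0+X_1$: $g\ll_K f$ implies $g\in X$ and $\|g\|_X\le\|f\|_X$. For couples $\vec X,\vec Y$, $\mathcal L(\vec X,\vec Y)$ is the space of linear $S:X_0+X_1\to Y_0+Y_1$ with $SX_i\subseteq Y_i$ and $S:X_i\to Y_i$ bounded ($i=0,1$), normed by $\|S\|_{\mathcal L(\vec X,\vec Y)}=\max_i\|S\|_{\mathcal L(X_i,Y_i)}$; $\mathcal L^+(\vec X,\vec Y)$ is the cone of positive operators in it; $\mathcal L(\vec X)=\mathcal L(\vec X,\vec X)$, $\mathcal L^+(\vec X)=\mathcal L^+(\vec X,\vec X)$. A contraction is an element of norm $\le1$. An intermediate space $X$ is an exact interpolation space for positive, linear operators if every $S\in\mathcal L^+(\vec X)$ satisfies $SX\subseteq X$ and $\|S\|_{\mathcal L(X)}\le\|S\|_{\mathcal L(\vec X)}$. $\vec X$ is an exact Calderón-Mityagin couple with respect to positive operators if for all positive $f,g\in X_0+X_1$ with $K(g,\cdot)\le K(f,\cdot)$ there is $T\in\mathcal L^+(\vec X)$ with $\|T\|_{\mathcal L(\vec X)}\le1$ and $Tf=g$. A Banach lattice is $\sigma$-Dedekind complete if every nonempty countable subset bounded from above has a supremum. A principal band projection is the canonical (band) projection of $X_0+X_1$ onto a band generated by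 a single element; $P\vec X=(PX_0,PX_1)$, and similarly for $Q$, $I-P$, $I-Q$. *)

theory Defs
  imports Complex_Main "HOL-Library.Countable_Set" "HOL-Algebra.Lattice"
begin

class hausdorff_tvs = real_vector + topological_ab_group_add + t2_space +
  assumes tendsto_scaleR_Pair_tvs:
    "LIM p (nhds (c::real) \<times>\<^sub>F nhds x). fst p *\<^sub>R snd p :> nhds (c *\<^sub>R x)"

text \<open>All spaces live inside an ambient vector space and are given by a set of points together
  with a norm, whose values off that set are irrelevant. Likewise, operators are functions on the
  ambient type that matter only on the space on which they are defined.\<close>

record 'a nspace =
  points :: "'a set"
  nrm :: "'a \<Rightarrow> real"

definition banach_space :: "'a::real_vector nspace \<Rightarrow> bool" where
  "banach_space E \<longleftrightarrow>
     subspace (points E) \<and>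
     (\<forall>x\<in>points E. nrm E x \<ge> 0 \<and> (nrm E x = 0 \<longleftrightarrow> x = 0)) \<and>
     (\<forall>c. \<forall>x\<in>points E. nrm E (c *\<^sub>R x) = \<bar>c\<bar> * nrm E x) \<and>
     (\<forall>x\<in>points E. \<forall>y\<in>points E. nrm E (x + y) \<le> nrm E x + nrm E y) \<and>
     (\<forall>s::nat \<Rightarrow> 'a. range s \<subseteq> points E \<longrightarrow>
        (\<forall>e>0. \<exists>N. \<forall>m\<ge>N. \<forall>n\<ge>N. nrm E (s m - s n) < e) \<longrightarrow>
        (\<exists>x\<in>points E. (\<lambda>n. nrm E (s n - x)) \<longlonglongrightarrow> 0))"

definition continuously_embedded_tvs :: "'a::hausdorff_tvs nspace \<Rightarrow> bool" where
  "continuously_embedded_tvs E \<longleftrightarrow>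
     (\<forall>U. open U \<longrightarrow> (\<forall>x\<in>points E \<inter> U. \<exists>e>0. \<forall>y\<in>points E. nrm E (y - x) < e \<longrightarrow> y \<in> U))"

definition continuously_embedded :: "'a nspace \<Rightarrow> 'a nspace \<Rightarrow> bool" where
  "continuously_embedded E F \<longleftrightarrow>
     points E \<subseteq> points F \<and> (\<exists>C. \<forall>x\<in>points E. nrm F x \<le> C * nrm E x)"


section \<open>Banach lattices\<close>

definition ord_on :: "('a \<Rightarrow> 'a \<Rightarrow> bool) \<Rightarrow> 'a set \<Rightarrow> 'a gorder" where
  "ord_on leq V = \<lparr>carrier = V, eq = (=), le = leq\<rparr>"

definition vector_lattice :: "('a::real_vector \<Rightarrow> 'a \<Rightarrow> bool) \<Rightarrow> 'a set \<Rightarrow> bool" where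
  "vector_lattice leq V \<longleftrightarrow>
     subspace V \<and> lattice (ord_on leq V) \<and>
     (\<forall>x\<in>V. \<forall>y\<in>V. \<forall>z\<in>V. leq x y \<longrightarrow> leq (x + z) (y + z)) \<and>
     (\<forall>x\<in>V. \<forall>y\<in>V. \<forall>c\<ge>0. leq x y \<longrightarrow> leq (c *\<^sub>R x) (c *\<^sub>R y))"

definition vabs :: "('a::real_vector \<Rightarrow> 'a \<Rightarrow> bool) \<Rightarrow> 'a set \<Rightarrow> 'a \<Rightarrow> 'a" where
  "vabs leq V x = x \<squnion>\<^bsub>ord_on leq V\<^esub> (- x)"

definition pos_part :: "('a::real_vector \<Rightarrow> 'a \<Rightarrow> bool) \<Rightarrow> 'a set \<Rightarrow> 'a \<Rightarrow> 'a" where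
  "pos_part leq V x = x \<squnion>\<^bsub>ord_on leq V\<^esub> 0"

definition neg_part :: "('a::real_vector \<Rightarrow> 'a \<Rightarrow> bool) \<Rightarrow> 'a set \<Rightarrow> 'a \<Rightarrow> 'a" where
  "neg_part leq V x = (- x) \<squnion>\<^bsub>ord_on leq V\<^esub> 0"

definition banach_lattice :: "('a::real_vector \<Rightarrow> 'a \<Rightarrow> bool) \<Rightarrow> 'a nspace \<Rightarrow> bool" where
  "banach_lattice leq E \<longleftrightarrow>
     banach_space E \<and> vector_lattice leq (points E) \<and>
     (\<forall>x\<in>points E. \<forall>y\<in>points E.
        leq (vabs leq (points E) x) (vabs leq (points E) y) \<longrightarrow> nrm E x \<le> nrm E y)"

definition order_ideal :: "('a::real_vector \<Rightarrow> 'a \<Rightarrow> bool) \<Rightarrow> 'a set \<Rightarrow> 'a set \<Rightarrow> bool" where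
  "order_ideal leq V I \<longleftrightarrow>
     subspace I \<and> I \<subseteq> V \<and>
     (\<forall>x\<in>I. \<forall>y\<in>V. leq (vabs leq V y) (vabs leq V x) \<longrightarrow> y \<in> I)"

definition sigma_dedekind_complete :: "('a \<Rightarrow> 'a \<Rightarrow> bool) \<Rightarrow> 'a set \<Rightarrow> bool" where
  "sigma_dedekind_complete leq V \<longleftrightarrow>
     (\<forall>A. A \<subseteq> V \<and> A \<noteq> {} \<and> countable A \<and> Upper (ord_on leq V) A \<noteq> {} \<longrightarrow>
        (\<exists>s. least (ord_on leq V) s (Upper (ord_on leq V) A)))"

definition band :: "('a::real_vector \<Rightarrow> 'a \<Rightarrow> bool) \<Rightarrow> 'a set \<Rightarrow> 'a set \<Rightarrow> bool" where
  "band leq V B \<longleftrightarrow>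
     order_ideal leq V B \<and>
     (\<forall>A s. A \<subseteq> B \<and> least (ord_on leq V) s (Upper (ord_on leq V) A) \<longrightarrow> s \<in> B)"

definition principal_band :: "('a::real_vector \<Rightarrow> 'a \<Rightarrow> bool) \<Rightarrow> 'a set \<Rightarrow> 'a \<Rightarrow> 'a set" where
  "principal_band leq V u = \<Inter> {B. band leq V B \<and> u \<in> B}"

definition disjoint_complement ::
    "('a::real_vector \<Rightarrow> 'a \<Rightarrow> bool) \<Rightarrow> 'a set \<Rightarrow> 'a set \<Rightarrow> 'a set" where
  "disjoint_complement leq V B =
     {y\<in>V. \<forall>b\<in>B. vabs leq V y \<sqinter>\<^bsub>ord_on leq V\<^esub> vabs leq V b = 0}"

text \<open>On \<open>V\<close>, the map \<open>P\<close> is the projection along the decomposition of \<open>V\<close> into the direct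
  sum of \<open>B\<close> and its disjoint complement; in particular, the existence of \<open>P\<close> entails
  that of the decomposition.\<close>

definition band_projection ::
    "('a::real_vector \<Rightarrow> 'a \<Rightarrow> bool) \<Rightarrow> 'a set \<Rightarrow> 'a set \<Rightarrow> ('a \<Rightarrow> 'a) \<Rightarrow> bool" where
  "band_projection leq V B P \<longleftrightarrow>
     (\<forall>x\<in>V. P x \<in> B \<and> x - P x \<in> disjoint_complement leq V B)"

definition principal_band_projection ::
    "('a::real_vector \<Rightarrow> 'a \<Rightarrow> bool) \<Rightarrow> 'a set \<Rightarrow> ('a \<Rightarrow> 'a) \<Rightarrow> bool" where
  "principal_band_projection leq V P \<longleftrightarrow>
     (\<exists>u\<in>V. band_projection leq V (principal_band leq V u) P)"


section \<open>Interpolation couples\<close>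

record 'a couple =
  cpl0 :: "'a nspace"
  cpl1 :: "'a nspace"

definition cap_space :: "'a couple \<Rightarrow> 'a nspace" where
  "cap_space X =
     \<lparr>points = points (cpl0 X) \<inter> points (cpl1 X),
      nrm = (\<lambda>f. nrm (cpl0 X) f + nrm (cpl1 X) f)\<rparr>"

definition K_functional :: "'a::real_vector couple \<Rightarrow> 'a \<Rightarrow> real \<Rightarrow> real" where
  "K_functional X f t =
     Inf {nrm (cpl0 X) f0 + t * nrm (cpl1 X) f1 | f0 f1.
            f0 \<in> points (cpl0 X) \<and> f1 \<in> points (cpl1 X) \<and> f = f0 + f1}"

definition sum_space :: "'a::real_vector couple \<Rightarrow> 'a nspace" where
  "sum_space X =
     \<lparr>points = {f0 + f1 | f0 f1. f0 \<in> points (cpl0 X) \<and> f1 \<in> points (cpl1 X)},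
      nrm = (\<lambda>f. Inf {nrm (cpl0 X) f0 + nrm (cpl1 X) f1 | f0 f1.
               f0 \<in> points (cpl0 X) \<and> f1 \<in> points (cpl1 X) \<and> f = f0 + f1})\<rparr>"

definition interpolation_couple :: "'a::hausdorff_tvs couple \<Rightarrow> bool" where
  "interpolation_couple X \<longleftrightarrow>
     banach_space (cpl0 X) \<and> banach_space (cpl1 X) \<and>
     continuously_embedded_tvs (cpl0 X) \<and> continuously_embedded_tvs (cpl1 X)"

definition compatible_lattice_couple ::
    "('a::hausdorff_tvs \<Rightarrow> 'a \<Rightarrow> bool) \<Rightarrow> 'a couple \<Rightarrow> bool" where
  "compatible_lattice_couple leq X \<longleftrightarrow>
     interpolation_couple X \<and>
     banach_lattice leq (cpl0 X) \<and> banach_lattice leq (cpl1 X) \<and>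
     banach_lattice leq (sum_space X) \<and>
     order_ideal leq (points (sum_space X)) (points (cpl0 X)) \<and>
     order_ideal leq (points (sum_space X)) (points (cpl1 X))"

definition intermediate_space :: "'a::real_vector couple \<Rightarrow> 'a nspace \<Rightarrow> bool" where
  "intermediate_space X E \<longleftrightarrow>
     banach_space E \<and>
     continuously_embedded (cap_space X) E \<and> continuously_embedded E (sum_space X)"

definition image_couple :: "('a \<Rightarrow> 'a) \<Rightarrow> 'a couple \<Rightarrow> 'a couple" where
  "image_couple P X =
     \<lparr>cpl0 = \<lparr>points = P ` points (cpl0 X), nrm = nrm (cpl0 X)\<rparr>,
      cpl1 = \<lparr>points = P ` points (cpl1 X), nrm = nrm (cpl1 X)\<rparr>\<rparr>"


section \<open>Operators\<close>

definition linear_op_on :: "'a::real_vector set \<Rightarrow> ('a \<Rightarrow> 'b::real_vector) \<Rightarrow> bool" where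
  "linear_op_on V S \<longleftrightarrow>
     (\<forall>x\<in>V. \<forall>y\<in>V. S (x + y) = S x + S y) \<and> (\<forall>c. \<forall>x\<in>V. S (c *\<^sub>R x) = c *\<^sub>R S x)"

definition bounded_op :: "'a nspace \<Rightarrow> 'b nspace \<Rightarrow> ('a \<Rightarrow> 'b) \<Rightarrow> bool" where
  "bounded_op E F S \<longleftrightarrow>
     S ` points E \<subseteq> points F \<and> (\<exists>C. \<forall>x\<in>points E. nrm F (S x) \<le> C * nrm E x)"

text \<open>The supremum is only meaningful for operators satisfying \<^const>\<open>bounded_op\<close>.\<close>

definition op_norm :: "'a nspace \<Rightarrow> 'b nspace \<Rightarrow> ('a \<Rightarrow> 'b) \<Rightarrow> real" where
  "op_norm E F S = Sup {nrm F (S x) | x. x \<in> points E \<and> nrm E x \<le> 1}"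

definition couple_ops ::
    "'a::real_vector couple \<Rightarrow> 'b::real_vector couple \<Rightarrow> ('a \<Rightarrow> 'b) set" where
  "couple_ops X Y =
     {S. linear_op_on (points (sum_space X)) S \<and>
         bounded_op (cpl0 X) (cpl0 Y) S \<and> bounded_op (cpl1 X) (cpl1 Y) S}"

definition couple_norm :: "'a couple \<Rightarrow> 'b couple \<Rightarrow> ('a \<Rightarrow> 'b) \<Rightarrow> real" where
  "couple_norm X Y S = max (op_norm (cpl0 X) (cpl0 Y) S) (op_norm (cpl1 X) (cpl1 Y) S)"

definition positive_couple_ops ::
    "('a::real_vector \<Rightarrow> 'a \<Rightarrow> bool) \<Rightarrow> 'a couple \<Rightarrow>
     ('b::real_vector \<Rightarrow> 'b \<Rightarrow> bool) \<Rightarrow> 'b couple \<Rightarrow> ('a \<Rightarrow> 'b) set" where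
  "positive_couple_ops leqX X leqY Y =
     {S \<in> couple_ops X Y. \<forall>f\<in>points (sum_space X). leqX 0 f \<longrightarrow> leqY 0 (S f)}"

definition contraction ::
    "'a::real_vector couple \<Rightarrow> 'b::real_vector couple \<Rightarrow> ('a \<Rightarrow> 'b) \<Rightarrow> bool" where
  "contraction X Y S \<longleftrightarrow> S \<in> couple_ops X Y \<and> couple_norm X Y S \<le> 1"

definition exact_interpolation_space_positive ::
    "('a::real_vector \<Rightarrow> 'a \<Rightarrow> bool) \<Rightarrow> 'a couple \<Rightarrow> 'a nspace \<Rightarrow> bool" where
  "exact_interpolation_space_positive leq X E \<longleftrightarrow>
     intermediate_space X E \<and>
     (\<forall>S\<in>positive_couple_ops leq X leq X. bounded_op E E S \<and> op_norm E E S \<le> couple_norm X X S)"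


section \<open>Monotonicity with respect to the K-functional\<close>

definition K_dominated ::
    "('a::real_vector \<Rightarrow> 'a \<Rightarrow> bool) \<Rightarrow> 'a couple \<Rightarrow> 'a \<Rightarrow> 'a \<Rightarrow> bool" where
  "K_dominated leq X g f \<longleftrightarrow>
     (let V = points (sum_space X) in
      \<forall>t>0. K_functional X (pos_part leq V g) t \<le> K_functional X (pos_part leq V f) t \<and>
            K_functional X (neg_part leq V g) t \<le> K_functional X (neg_part leq V f) t)"

definition exactly_partially_K_monotone ::
    "('a::real_vector \<Rightarrow> 'a \<Rightarrow> bool) \<Rightarrow> 'a couple \<Rightarrow> 'a nspace \<Rightarrow> bool" where
  "exactly_partially_K_monotone leq X E \<longleftrightarrow>
     intermediate_space X E \<and>
     (\<forall>f\<in>points E. \<forall>g\<in>points (sum_space X).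
        K_dominated leq X g f \<longrightarrow> g \<in> points E \<and> nrm E g \<le> nrm E f)"

definition exact_calderon_mityagin_positive ::
    "('a::real_vector \<Rightarrow> 'a \<Rightarrow> bool) \<Rightarrow> 'a couple \<Rightarrow> bool" where
  "exact_calderon_mityagin_positive leq X \<longleftrightarrow>
     (\<forall>f\<in>points (sum_space X). \<forall>g\<in>points (sum_space X).
        leq 0 f \<and> leq 0 g \<and> (\<forall>t>0. K_functional X g t \<le> K_functional X f t) \<longrightarrow>
        (\<exists>T\<in>positive_couple_ops leq X leq X. couple_norm X X T \<le> 1 \<and> T f = g))"

end

theory Submission
  imports Defs
begin

text \<open>
  Write \<open>V\<close> for the vector lattice \<open>X\<^sub>0 + X\<^sub>1\<close>.

  For the first part, it is enough that every positive contraction \<open>R\<close> of the couple satisfies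
  \<open>R f \<ll>\<^sub>K f\<close>; the operator \<open>S\<close> of norm \<open>c > 0\<close> is then handled through \<open>R = S / c\<close>. Positivity gives
  \<open>(R f)\<^sup>+ \<le> R f\<^sup>+\<close> and \<open>(R f)\<^sup>- \<le> R f\<^sup>-\<close>. Applying \<open>R\<close> to the summands of a splitting never makes it
  more expensive (\<open>K_positive_contraction\<close>), and \<open>K(\<cdot>, t)\<close> is monotone on the positive cone, because
  by Riesz decomposition a splitting of \<open>h\<close> induces a cheaper one of each \<open>g\<close> with \<open>0 \<le> g \<le> h\<close>
  (\<open>K_mono\<close>, where the ideal property puts the new summands into \<open>X\<^sub>0\<close> and \<open>X\<^sub>1\<close>).

  For the second part, let \<open>g \<ll>\<^sub>K f\<close> with \<open>f\<close> in the interpolation space. The Calderon-Mityagin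
  property provides positive contractions with \<open>R\<^sub>1 f\<^sup>+ = g\<^sup>+\<close> and \<open>R\<^sub>2 f\<^sup>- = g\<^sup>-\<close>, and the task is to
  merge them into one positive contraction that sends \<open>f\<close> to \<open>g\<close>. Let \<open>P\<close> and \<open>Q\<close> be the projections
  onto the bands generated by \<open>f\<^sup>+\<close> and \<open>g\<^sup>+\<close>. Since positive and negative parts are disjoint,
  \<open>P f = f\<^sup>+\<close> and \<open>f - P f = - f\<^sup>-\<close>, and likewise for \<open>g\<close>. Hence the diagonal operator with entries
  \<open>Q R\<^sub>1\<close> and \<open>(I - Q) R\<^sub>2\<close> maps \<open>f\<close> to \<open>g\<^sup>+ - g\<^sup>- = g\<close>, and it is a contraction by the third hypothesis.

  The projections have to be constructed, since completeness is assumed for \<open>X\<^sub>0\<close> and \<open>X\<^sub>1\<close> and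
  not for \<open>V\<close>. A positive \<open>x\<close> in \<open>X\<^sub>i\<close> has the component \<open>sup\<^sub>n (x \<and> n u)\<close> in the band generated
  by \<open>u\<close> (\<open>principal_band_decomposition\<close>). As a band and its disjoint complement are subspaces, the
  decompositions on \<open>X\<^sub>0\<close> and \<open>X\<^sub>1\<close> add up to one on \<open>V\<close> (\<open>principal_band_projection_exists\<close>).
\<close>

section \<open>Elementary theory of vector lattices\<close>

lemma is_lub_iff:
  assumes "A \<subseteq> W"
  shows "least (ord_on leq W) s (Upper (ord_on leq W) A) \<longleftrightarrow>
    s \<in> W \<and> (\<forall>a\<in>A. leq a s) \<and> (\<forall>z\<in>W. (\<forall>a\<in>A. leq a z) \<longrightarrow> leq s z)"
proof -
  have "Upper (ord_on leq W) A = {z \<in> W. \<forall>a\<in>A. leq a z}"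
    using assms by (auto simp: Upper_def ord_on_def)
  then show ?thesis by (auto simp: least_def ord_on_def)
qed

locale riesz_space =
  fixes leq :: "'a::real_vector \<Rightarrow> 'a \<Rightarrow> bool" (infix "\<preceq>" 50) and V :: "'a set"
  assumes vector_lattice: "vector_lattice leq V"
begin

abbreviation join_V (infixl "\<squnion>\<^sub>V" 65) where "x \<squnion>\<^sub>V y \<equiv> x \<squnion>\<^bsub>ord_on leq V\<^esub> y"
abbreviation meet_V (infixl "\<sqinter>\<^sub>V" 70) where "x \<sqinter>\<^sub>V y \<equiv> x \<sqinter>\<^bsub>ord_on leq V\<^esub> y"
abbreviation "modulus \<equiv> vabs leq V"
abbreviation "pos \<equiv> pos_part leq V"
abbreviation "neg \<equiv> neg_part leq V"

lemma subspace_V: "subspace V"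
  using vector_lattice by (simp add: vector_lattice_def)

lemmas zero_closed [simp] = subspace_0[OF subspace_V]
lemmas add_closed [simp] = subspace_add[OF subspace_V]
lemmas diff_closed [simp] = subspace_diff[OF subspace_V]
lemmas minus_closed [simp] = subspace_neg[OF subspace_V]
lemmas scale_closed [simp] = subspace_scale[OF subspace_V]

interpretation L: lattice "ord_on leq V"
  rewrites "carrier (ord_on leq V) = V" and "le (ord_on leq V) = leq"
  using vector_lattice by (auto simp: vector_lattice_def ord_on_def)

lemma leq_refl [simp]: "x \<in> V \<Longrightarrow> x \<preceq> x"
  by simp

lemma leq_trans: "\<lbrakk>x \<preceq> y; y \<preceq> z; x \<in> V; y \<in> V; z \<in> V\<rbrakk> \<Longrightarrow> x \<preceq> z"
  using L.le_trans by blast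

lemma leq_antisym: "\<lbrakk>x \<preceq> y; y \<preceq> x; x \<in> V; y \<in> V\<rbrakk> \<Longrightarrow> x = y"
  using L.le_antisym by blast

lemma join_closed [simp]: "\<lbrakk>x \<in> V; y \<in> V\<rbrakk> \<Longrightarrow> x \<squnion>\<^sub>V y \<in> V"
  by simp

lemma meet_closed [simp]: "\<lbrakk>x \<in> V; y \<in> V\<rbrakk> \<Longrightarrow> x \<sqinter>\<^sub>V y \<in> V"
  by simp

lemma join_left: "\<lbrakk>x \<in> V; y \<in> V\<rbrakk> \<Longrightarrow> x \<preceq> x \<squnion>\<^sub>V y"
  using L.join_left by blast

lemma join_right: "\<lbrakk>x \<in> V; y \<in> V\<rbrakk> \<Longrightarrow> y \<preceq> x \<squnion>\<^sub>V y"
  using L.join_right by blast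

lemma join_least: "\<lbrakk>x \<preceq> z; y \<preceq> z; x \<in> V; y \<in> V; z \<in> V\<rbrakk> \<Longrightarrow> x \<squnion>\<^sub>V y \<preceq> z"
  using L.join_le by blast

lemma meet_left: "\<lbrakk>x \<in> V; y \<in> V\<rbrakk> \<Longrightarrow> x \<sqinter>\<^sub>V y \<preceq> x"
  using L.meet_left by blast

lemma meet_right: "\<lbrakk>x \<in> V; y \<in> V\<rbrakk> \<Longrightarrow> x \<sqinter>\<^sub>V y \<preceq> y"
  using L.meet_right by blast

lemma meet_greatest: "\<lbrakk>z \<preceq> x; z \<preceq> y; x \<in> V; y \<in> V; z \<in> V\<rbrakk> \<Longrightarrow> z \<preceq> x \<sqinter>\<^sub>V y"
  using L.meet_le by blast

text \<open>The order is determined by differences; this reduces every translation or reflection of an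
  inequality to an identity between differences.\<close>

lemma leq_shift:
  assumes "x \<preceq> y" "y - x = y' - x'" and "x \<in> V" "y \<in> V" "x' \<in> V" "y' \<in> V"
  shows "x' \<preceq> y'"
proof -
  have "x + (x' - x) \<preceq> y + (x' - x)"
    using vector_lattice assms(1,3-6) diff_closed[of x' x] unfolding vector_lattice_def by blast
  moreover have "y + (x' - x) = y'"
    using assms(2) by (simp add: algebra_simps)
  ultimately show ?thesis by simp
qed

lemma scale_mono: "\<lbrakk>x \<preceq> y; 0 \<le> c; x \<in> V; y \<in> V\<rbrakk> \<Longrightarrow> c *\<^sub>R x \<preceq> c *\<^sub>R y"
  using vector_lattice by (simp add: vector_lattice_def)

lemma add_mono:
  assumes "x \<preceq> y" "x' \<preceq> y'" "x \<in> V" "y \<in> V" "x' \<in> V" "y' \<in> V"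
  shows "x + x' \<preceq> y + y'"
proof (rule leq_trans[of _ "y + x'"])
  show "x + x' \<preceq> y + x'" using assms by (auto intro: leq_shift[of x y])
  show "y + x' \<preceq> y + y'" using assms by (auto intro: leq_shift[of x' y'])
qed (use assms in auto)

lemma neg_mono: "\<lbrakk>x \<preceq> y; x \<in> V; y \<in> V\<rbrakk> \<Longrightarrow> - y \<preceq> - x"
  by (rule leq_shift[of x y]) auto

lemma le_add_nonneg: "\<lbrakk>0 \<preceq> y; x \<in> V; y \<in> V\<rbrakk> \<Longrightarrow> x \<preceq> x + y"
  by (rule leq_shift[of 0 y]) auto

lemma diff_le_self: "\<lbrakk>0 \<preceq> y; x \<in> V; y \<in> V\<rbrakk> \<Longrightarrow> x - y \<preceq> x"
  by (rule leq_shift[of 0 y]) auto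

lemma scale_le_scale:
  assumes "0 \<preceq> x" "c \<le> d" "x \<in> V"
  shows "c *\<^sub>R x \<preceq> d *\<^sub>R x"
proof (rule leq_shift[of "0" "(d - c) *\<^sub>R x"])
  show "0 \<preceq> (d - c) *\<^sub>R x"
    using scale_mono[of 0 x "d - c"] assms by simp
qed (use assms in \<open>auto simp: scaleR_diff_left\<close>)

lemma modulus_closed [simp]: "x \<in> V \<Longrightarrow> modulus x \<in> V"
  by (simp add: vabs_def)

lemma pos_closed [simp]: "x \<in> V \<Longrightarrow> pos x \<in> V"
  by (simp add: pos_part_def)

lemma neg_closed [simp]: "x \<in> V \<Longrightarrow> neg x \<in> V"
  by (simp add: neg_part_def)

lemma le_modulus: "x \<in> V \<Longrightarrow> x \<preceq> modulus x"
  by (simp add: vabs_def join_left)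

lemma minus_le_modulus: "x \<in> V \<Longrightarrow> - x \<preceq> modulus x"
  by (simp add: vabs_def join_right)

lemma modulus_least: "\<lbrakk>x \<preceq> z; - x \<preceq> z; x \<in> V; z \<in> V\<rbrakk> \<Longrightarrow> modulus x \<preceq> z"
  by (simp add: vabs_def join_least)

lemma modulus_nonneg:
  assumes "x \<in> V"
  shows "0 \<preceq> modulus x"
proof -
  have "x + - x \<preceq> modulus x + modulus x"
    by (rule add_mono) (use assms in \<open>auto intro: le_modulus minus_le_modulus\<close>)
  then have "(1/2) *\<^sub>R 0 \<preceq> (1/2) *\<^sub>R (modulus x + modulus x)"
    using assms by (intro scale_mono) auto
  then show ?thesis by (simp flip: scaleR_add_left add: scaleR_add_right)
qed

lemma modulus_of_nonneg:
  assumes "0 \<preceq> x" "x \<in> V"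
  shows "modulus x = x"
proof (rule leq_antisym)
  have "- x \<preceq> x"
    using neg_mono[of 0 x] assms by (auto intro: leq_trans[of "- x" 0 x])
  then show "modulus x \<preceq> x" using assms by (intro modulus_least) auto
qed (use assms in \<open>auto intro: le_modulus\<close>)

lemma modulus_minus: "x \<in> V \<Longrightarrow> modulus (- x) = modulus x"
  using modulus_least[of x "modulus (- x)"] modulus_least[of "- x" "modulus x"]
    le_modulus[of "- x"] minus_le_modulus[of "- x"] le_modulus[of x] minus_le_modulus[of x]
  by (auto intro: leq_antisym)

lemma modulus_triangle:
  assumes "x \<in> V" "y \<in> V"
  shows "modulus (x + y) \<preceq> modulus x + modulus y"
proof (rule modulus_least)
  show "x + y \<preceq> modulus x + modulus y"
    using assms by (auto intro: add_mono le_modulus)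
  have "- x + - y \<preceq> modulus x + modulus y"
    using assms by (intro add_mono minus_le_modulus) auto
  then show "- (x + y) \<preceq> modulus x + modulus y" by simp
qed (use assms in auto)

lemma modulus_scale_le:
  assumes "x \<in> V"
  shows "modulus (c *\<^sub>R x) \<preceq> \<bar>c\<bar> *\<^sub>R modulus x"
proof -
  have *: "modulus (c *\<^sub>R y) \<preceq> c *\<^sub>R modulus y" if "y \<in> V" "0 \<le> c" for c y
  proof (rule modulus_least)
    show "c *\<^sub>R y \<preceq> c *\<^sub>R modulus y"
      using that by (intro scale_mono le_modulus) auto
    have "c *\<^sub>R (- y) \<preceq> c *\<^sub>R modulus y"
      using that by (intro scale_mono minus_le_modulus) auto
    then show "- (c *\<^sub>R y) \<preceq> c *\<^sub>R modulus y" by simp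
  qed (use that in auto)
  show ?thesis
  proof (cases "0 \<le> c")
    case False
    then show ?thesis
      using *[of "- x" "- c"] assms modulus_minus[of x] by simp
  qed (use *[OF assms] in simp)
qed

lemma pos_nonneg: "x \<in> V \<Longrightarrow> 0 \<preceq> pos x"
  by (simp add: pos_part_def join_right)

lemma le_pos: "x \<in> V \<Longrightarrow> x \<preceq> pos x"
  by (simp add: pos_part_def join_left)

lemma pos_least: "\<lbrakk>x \<preceq> z; 0 \<preceq> z; x \<in> V; z \<in> V\<rbrakk> \<Longrightarrow> pos x \<preceq> z"
  by (simp add: pos_part_def join_least)

lemma neg_eq_pos_minus: "neg x = pos (- x)"
  by (simp add: pos_part_def neg_part_def)

lemma neg_nonneg: "x \<in> V \<Longrightarrow> 0 \<preceq> neg x"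
  by (simp add: neg_eq_pos_minus pos_nonneg)

lemma pos_le_modulus: "x \<in> V \<Longrightarrow> pos x \<preceq> modulus x"
  by (auto intro: pos_least le_modulus modulus_nonneg)

lemma neg_le_modulus: "x \<in> V \<Longrightarrow> neg x \<preceq> modulus x"
  using pos_le_modulus[of "- x"] by (simp add: neg_eq_pos_minus modulus_minus)

text \<open>Translating the supremum of \<open>x\<close> and \<open>0\<close> by \<open>- x\<close> gives the supremum of \<open>0\<close> and \<open>- x\<close>.\<close>

lemma pos_eq_add_neg:
  assumes "x \<in> V"
  shows "pos x = x + neg x"
proof (rule leq_antisym)
  have "0 \<preceq> neg x" "- x \<preceq> neg x"
    using assms le_pos[of "- x"] by (auto intro: neg_nonneg simp: neg_eq_pos_minus[of x])
  then have "x \<preceq> x + neg x" "0 \<preceq> x + neg x"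
    using assms by (auto intro: le_add_nonneg leq_shift[of "- x" "neg x"])
  then show "pos x \<preceq> x + neg x" using assms by (intro pos_least) auto
  have "- x \<preceq> pos x - x" "0 \<preceq> pos x - x"
    using assms by (auto intro: leq_shift[OF pos_nonneg] leq_shift[OF le_pos])
  then have "neg x \<preceq> pos x - x"
    using assms by (auto simp: neg_eq_pos_minus intro: pos_least)
  then show "x + neg x \<preceq> pos x"
    by (rule leq_shift) (use assms in \<open>auto simp: algebra_simps\<close>)
qed (use assms in auto)

lemma pos_minus_neg: "x \<in> V \<Longrightarrow> pos x - neg x = x"
  by (simp add: pos_eq_add_neg)

lemma neg_of_diff_pos: "x \<in> V \<Longrightarrow> x - pos x = - neg x"
  by (simp add: pos_eq_add_neg)

text \<open>The witnesses are \<open>g \<sqinter> a\<close> and \<open>g - g \<sqinter> a\<close>; the latter is below \<open>b\<close> because \<open>g - b\<close> is a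
  lower bound of both \<open>g\<close> and \<open>a\<close>.\<close>

lemma riesz_decomposition:
  assumes "0 \<preceq> g" "g \<preceq> a + b" "0 \<preceq> a" "0 \<preceq> b" and V: "g \<in> V" "a \<in> V" "b \<in> V"
  obtains g0 g1 where "g0 \<in> V" "g1 \<in> V" "g = g0 + g1"
    "0 \<preceq> g0" "g0 \<preceq> a" "0 \<preceq> g1" "g1 \<preceq> b"
proof
  let ?g0 = "g \<sqinter>\<^sub>V a"
  show "g = ?g0 + (g - ?g0)" by simp
  show "0 \<preceq> ?g0" using assms by (auto intro: meet_greatest)
  show "?g0 \<preceq> a" using assms by (auto intro: meet_right)
  show "0 \<preceq> g - ?g0"
    by (rule leq_shift[of ?g0 g]) (use V in \<open>auto intro: meet_left\<close>)
  have "g - b \<preceq> g" "g - b \<preceq> a"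
    using assms(4) V leq_shift[OF assms(2), of a "g - b"] by (auto intro: diff_le_self)
  then have "g - b \<preceq> ?g0" using V by (auto intro: meet_greatest)
  then show "g - ?g0 \<preceq> b"
    by (rule leq_shift) (use V in auto)
qed (use V in auto)


section \<open>Disjointness and bands\<close>

definition disjoint (infix "\<bottom>\<^sub>V" 50) where
  "x \<bottom>\<^sub>V y \<longleftrightarrow> modulus x \<sqinter>\<^sub>V modulus y = 0"

lemma disjoint_complement_iff:
  "y \<in> disjoint_complement leq V B \<longleftrightarrow> y \<in> V \<and> (\<forall>b\<in>B. y \<bottom>\<^sub>V b)"
  by (simp add: disjoint_complement_def disjoint_def)

text \<open>An infimum of two positive elements is automatically positive, so disjointness amounts to
  the absence of positive common lower bounds other than \<open>0\<close>.\<close>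

lemma disjointI:
  assumes "\<And>w. \<lbrakk>w \<in> V; 0 \<preceq> w; w \<preceq> modulus x; w \<preceq> modulus y\<rbrakk> \<Longrightarrow> w \<preceq> 0"
    and V: "x \<in> V" "y \<in> V"
  shows "x \<bottom>\<^sub>V y"
proof -
  let ?w = "modulus x \<sqinter>\<^sub>V modulus y"
  have "0 \<preceq> ?w" using V by (auto intro: meet_greatest modulus_nonneg)
  moreover have "?w \<preceq> 0"
    using calculation V by (intro assms(1)) (auto intro: meet_left meet_right)
  ultimately show ?thesis
    using V by (auto simp: disjoint_def intro: leq_antisym)
qed

lemma disjointD:
  assumes "x \<bottom>\<^sub>V y" "w \<preceq> modulus x" "w \<preceq> modulus y" "w \<in> V" "x \<in> V" "y \<in> V"
  shows "w \<preceq> 0"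
  using assms meet_greatest[of w "modulus x" "modulus y"] by (simp add: disjoint_def)

lemma disjoint_sym: "\<lbrakk>x \<bottom>\<^sub>V y; x \<in> V; y \<in> V\<rbrakk> \<Longrightarrow> y \<bottom>\<^sub>V x"
  by (auto intro: disjointI disjointD)

lemma disjoint_mono:
  assumes "x \<bottom>\<^sub>V y" "modulus z \<preceq> modulus x" "x \<in> V" "y \<in> V" "z \<in> V"
  shows "z \<bottom>\<^sub>V y"
proof (rule disjointI)
  fix w assume w: "w \<in> V" "w \<preceq> modulus z" "w \<preceq> modulus y"
  then have "w \<preceq> modulus x" using assms by (auto intro: leq_trans[of w "modulus z"])
  then show "w \<preceq> 0" using assms w disjointD by blast
qed (use assms in auto)

text \<open>A common lower bound \<open>w\<close> of \<open>|x| + |y|\<close> and \<open>|z|\<close> satisfies \<open>w - |y| \<preceq> 0\<close> by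
  disjointness of \<open>x\<close> and \<open>z\<close>, whence \<open>w\<close> is a common lower bound of \<open>|y|\<close> and \<open>|z|\<close>.\<close>

lemma disjoint_add:
  assumes "x \<bottom>\<^sub>V z" "y \<bottom>\<^sub>V z" and V: "x \<in> V" "y \<in> V" "z \<in> V"
  shows "x + y \<bottom>\<^sub>V z"
proof (rule disjointI)
  fix w assume w: "w \<in> V" "w \<preceq> modulus (x + y)" "w \<preceq> modulus z"
  have "w \<preceq> modulus x + modulus y"
    using w V modulus_triangle[of x y] by (auto intro: leq_trans[of w "modulus (x + y)"])
  then have 1: "w - modulus y \<preceq> modulus x"
    by (rule leq_shift) (use w V in auto)
  have "w - modulus y \<preceq> w" using w V by (auto intro: diff_le_self modulus_nonneg)
  then have 2: "w - modulus y \<preceq> modulus z"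
    using w V by (auto intro: leq_trans[of _ w])
  have "w - modulus y \<preceq> 0"
    using disjointD[OF assms(1) 1 2] w V by simp
  then have "w \<preceq> modulus y"
    by (rule leq_shift) (use w V in auto)
  then show "w \<preceq> 0" using disjointD[OF assms(2)] w V by simp
qed (use V in auto)

lemma disjoint_scale:
  assumes "x \<bottom>\<^sub>V z" and V: "x \<in> V" "z \<in> V"
  shows "c *\<^sub>R x \<bottom>\<^sub>V z"
proof (rule disjointI)
  fix w assume w: "w \<in> V" "0 \<preceq> w" "w \<preceq> modulus (c *\<^sub>R x)" "w \<preceq> modulus z"
  \<comment> \<open>Shrinking \<open>w\<close> by a factor \<open>m\<close> that is at least \<open>|c|\<close> and \<open>1\<close> puts it below both moduli.\<close>
  define m where "m = max 1 \<bar>c\<bar>"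
  have m: "m \<ge> 1" "\<bar>c\<bar> \<le> m" "m > 0" by (auto simp: m_def)
  have "w \<preceq> \<bar>c\<bar> *\<^sub>R modulus x"
    using w V modulus_scale_le[of x c] by (auto intro: leq_trans[of w "modulus (c *\<^sub>R x)"])
  moreover have "\<bar>c\<bar> *\<^sub>R modulus x \<preceq> m *\<^sub>R modulus x"
    using V m by (auto intro: scale_le_scale modulus_nonneg)
  ultimately have "w \<preceq> m *\<^sub>R modulus x"
    using w V by (auto intro: leq_trans[of w "\<bar>c\<bar> *\<^sub>R modulus x"])
  then have "(1/m) *\<^sub>R w \<preceq> (1/m) *\<^sub>R m *\<^sub>R modulus x"
    using w V m by (intro scale_mono) auto
  then have 1: "(1/m) *\<^sub>R w \<preceq> modulus x" using m by simp
  have "(1/m) *\<^sub>R w \<preceq> w"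
    using scale_le_scale[of w "1/m" 1] w m by simp
  then have 2: "(1/m) *\<^sub>R w \<preceq> modulus z"
    using w V by (auto intro: leq_trans[of _ w])
  have "(1/m) *\<^sub>R w \<preceq> 0"
    using disjointD[OF assms(1) 1 2] w V by simp
  then have "m *\<^sub>R (1/m) *\<^sub>R w \<preceq> m *\<^sub>R 0"
    using w m by (intro scale_mono) auto
  then show "w \<preceq> 0" using m by simp
qed (use V in auto)

lemma disjoint_zero:
  assumes "y \<in> V"
  shows "0 \<bottom>\<^sub>V y"
  by (rule disjointI) (use assms in \<open>auto simp: modulus_of_nonneg\<close>)

lemma disjoint_self_eq_0:
  assumes "x \<bottom>\<^sub>V x" "x \<in> V"
  shows "x = 0"
proof (rule leq_antisym)
  have 0: "modulus x \<preceq> 0" using assms disjointD by simp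
  then show "x \<preceq> 0" using assms le_modulus by (auto intro: leq_trans[of x "modulus x"])
  have "- x \<preceq> 0"
    using assms 0 minus_le_modulus by (auto intro: leq_trans[of _ "modulus x"])
  then show "0 \<preceq> x" by (rule leq_shift) (use assms in auto)
qed (use assms in auto)

text \<open>Any common lower bound \<open>w\<close> of \<open>pos x\<close> and \<open>neg x\<close> could be subtracted from \<open>pos x\<close> while
  leaving it above \<open>x\<close> and \<open>0\<close>.\<close>

lemma disjoint_pos_neg:
  assumes "x \<in> V"
  shows "pos x \<bottom>\<^sub>V neg x"
proof (rule disjointI)
  fix w assume w: "w \<in> V" "w \<preceq> modulus (pos x)" "w \<preceq> modulus (neg x)"
  have w: "w \<in> V" "w \<preceq> pos x" "w \<preceq> neg x"
    using w assms by (auto simp: modulus_of_nonneg pos_nonneg neg_nonneg)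
  have "x \<preceq> pos x - w" "0 \<preceq> pos x - w"
    using w(1) assms leq_shift[OF w(2), of "pos x - w" 0] leq_shift[OF w(3), of "pos x - w" x]
    by (auto simp: pos_eq_add_neg)
  then have "pos x \<preceq> pos x - w" using w assms by (auto intro: pos_least)
  then show "w \<preceq> 0" by (rule leq_shift) (use w assms in auto)
qed (use assms in auto)

text \<open>For disjoint positive elements the sum is the supremum: \<open>a + b - s\<close> is a common lower bound
  of \<open>a\<close> and \<open>b\<close>.\<close>

lemma disjoint_nonneg_add_le:
  assumes "a \<bottom>\<^sub>V b" "0 \<preceq> a" "0 \<preceq> b" "a \<preceq> s" "b \<preceq> s" "a \<in> V" "b \<in> V" "s \<in> V"
  shows "a + b \<preceq> s"
proof -
  have "a + b - s \<preceq> a" "a + b - s \<preceq> b"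
    using assms(6-8) leq_shift[OF assms(5), of a "a + b - s"]
      leq_shift[OF assms(4), of b "a + b - s"] by auto
  then have "a + b - s \<preceq> 0"
    using assms by (auto intro!: disjointD[OF assms(1)] simp: modulus_of_nonneg)
  then show ?thesis by (rule leq_shift) (use assms in auto)
qed

lemma subspace_disjoint_complement:
  assumes "B \<subseteq> V"
  shows "subspace (disjoint_complement leq V B)"
  using assms
  by (auto simp: subspace_def disjoint_complement_iff disjoint_zero
      intro: disjoint_add disjoint_scale)

text \<open>Closure under suprema: for \<open>s = sup A\<close> with \<open>A\<close> disjoint from \<open>d\<close>, the negative part of
  \<open>s\<close> lies below that of any element of \<open>A\<close>. A common lower bound \<open>w\<close> of \<open>pos s\<close> and \<open>|d|\<close>
  is disjoint from each \<open>pos a\<close>, so \<open>pos a + w \<preceq> pos s\<close>; hence \<open>pos s - w\<close> is again an upper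
  bound of \<open>A\<close>.\<close>

lemma band_disjoint_complement_singleton:
  assumes d: "d \<in> V"
  shows "band leq V (disjoint_complement leq V {d})" (is "band leq V ?D")
proof -
  have D: "y \<in> ?D \<longleftrightarrow> y \<in> V \<and> y \<bottom>\<^sub>V d" for y
    by (simp add: disjoint_complement_iff)
  have "order_ideal leq V ?D"
    unfolding order_ideal_def
    using subspace_disjoint_complement[of "{d}"] d by (auto simp: D intro: disjoint_mono)
  moreover have "s \<in> ?D"
    if A: "A \<subseteq> ?D" and lub: "least (ord_on leq V) s (Upper (ord_on leq V) A)" for A s
  proof -
    have AV: "A \<subseteq> V" using A D by blast
    have s: "s \<in> V" and ub: "\<And>a. a \<in> A \<Longrightarrow> a \<preceq> s"
      and least: "\<And>z. \<lbrakk>z \<in> V; \<And>a. a \<in> A \<Longrightarrow> a \<preceq> z\<rbrakk> \<Longrightarrow> s \<preceq> z"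
      using lub AV by (auto simp: is_lub_iff)
    have "pos s \<bottom>\<^sub>V d"
    proof (rule disjointI)
      fix w assume w: "w \<in> V" "0 \<preceq> w" "w \<preceq> modulus (pos s)" "w \<preceq> modulus d"
      have ws: "w \<preceq> pos s" using w s by (simp add: modulus_of_nonneg pos_nonneg)
      have wd: "modulus w \<preceq> modulus d" using w by (simp add: modulus_of_nonneg)
      have "a \<preceq> pos s - w" if a: "a \<in> A" for a
      proof -
        have aV: "a \<in> V" and ad: "a \<bottom>\<^sub>V d" using a A D by auto
        have "modulus (pos a) \<preceq> modulus a"
          using aV by (simp add: modulus_of_nonneg pos_nonneg pos_le_modulus)
        then have "pos a \<bottom>\<^sub>V d" using disjoint_mono[OF ad] aV d by simp
        then have "d \<bottom>\<^sub>V pos a" by (rule disjoint_sym) (use aV d in auto)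
        then have "w \<bottom>\<^sub>V pos a" using disjoint_mono[OF _ wd] w d aV by simp
        then have "pos a \<bottom>\<^sub>V w" by (rule disjoint_sym) (use aV w in auto)
        moreover have "pos a \<preceq> pos s"
          using ub[OF a] aV s le_pos[of s]
          by (auto intro!: pos_least pos_nonneg intro: leq_trans[of a s])
        ultimately have "pos a + w \<preceq> pos s"
          using aV w ws s by (auto intro: disjoint_nonneg_add_le pos_nonneg)
        then have "pos a \<preceq> pos s - w"
          by (rule leq_shift) (use aV w s in auto)
        then show ?thesis
          using aV w s le_pos[of a] by (auto intro: leq_trans[of a "pos a"])
      qed
      then have "s \<preceq> pos s - w" using w s by (auto intro: least)
      moreover have "0 \<preceq> pos s - w"
        using ws by (rule leq_shift) (use w s in auto)
      ultimately have "pos s \<preceq> pos s - w" using w s by (auto intro: pos_least)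
      then show "w \<preceq> 0" by (rule leq_shift) (use w s in auto)
    qed (use d s in auto)
    moreover have "neg s \<bottom>\<^sub>V d"
    proof (cases "A = {}")
      case True
      \<comment> \<open>A supremum of the empty set is a least element, which in a vector space must be \<open>0\<close>.\<close>
      have "s \<preceq> s + s" using least True s by simp
      then have "0 \<preceq> s" by (rule leq_shift) (use s in auto)
      moreover have "s \<preceq> 0" using least True by simp
      ultimately have "s = 0" using s by (auto intro: leq_antisym)
      then show ?thesis
        using d leq_antisym[OF pos_least[of 0 0] pos_nonneg[of 0]]
        by (simp add: neg_eq_pos_minus disjoint_zero)
    next
      case False
      then obtain a where a: "a \<in> A" by blast
      then have aV: "a \<in> V" and ad: "a \<bottom>\<^sub>V d" using A D by auto
      have "- s \<preceq> - a" using ub[OF a] aV s by (rule neg_mono)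
      then have "- s \<preceq> modulus a"
        using aV s minus_le_modulus[of a] by (auto intro: leq_trans[of _ "- a"])
      then have "neg s \<preceq> modulus a"
        using aV s by (auto simp: neg_eq_pos_minus intro!: pos_least modulus_nonneg)
      then show ?thesis
        using disjoint_mono[OF ad] aV s d by (simp add: modulus_of_nonneg neg_nonneg)
    qed
    then have "(- 1) *\<^sub>R neg s \<bottom>\<^sub>V d" using s d by (intro disjoint_scale) auto
    ultimately have "pos s + (- 1) *\<^sub>R neg s \<bottom>\<^sub>V d"
      using s d by (intro disjoint_add) auto
    then show ?thesis using s D pos_minus_neg[of s] by simp
  qed
  ultimately show ?thesis unfolding band_def by blast
qed

lemma band_V: "band leq V V"
  by (auto simp: band_def order_ideal_def subspace_V least_def ord_on_def Upper_def)

lemma principal_band_closed: "u \<in> V \<Longrightarrow> principal_band leq V u \<subseteq> V"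
  using band_V by (auto simp: principal_band_def)

lemma generator_in_principal_band: "u \<in> principal_band leq V u"
  by (auto simp: principal_band_def)

lemma order_ideal_principal_band:
  assumes "u \<in> V"
  shows "order_ideal leq V (principal_band leq V u)"
proof -
  have "subspace (principal_band leq V u)"
    unfolding principal_band_def by (rule subspace_Inter) (auto simp: band_def order_ideal_def)
  then show ?thesis
    using principal_band_closed[OF assms]
    by (auto simp: order_ideal_def) (auto simp: principal_band_def band_def order_ideal_def)
qed

lemma principal_band_lub_closed:
  assumes "A \<subseteq> principal_band leq V u" "least (ord_on leq V) s (Upper (ord_on leq V) A)"
  shows "s \<in> principal_band leq V u"
  unfolding principal_band_def
proof clarify
  fix B assume "band leq V B" "u \<in> B"
  moreover have "A \<subseteq> B" using assms(1) calculation by (auto simp: principal_band_def)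
  ultimately show "s \<in> B" using assms(2) by (auto simp: band_def)
qed

text \<open>The elements disjoint from \<open>d\<close> form a band, so if \<open>u\<close> is one of them, then they include the
  whole band generated by \<open>u\<close>.\<close>

lemma disjoint_from_generator:
  assumes "d \<bottom>\<^sub>V u" "d \<in> V" "u \<in> V"
  shows "d \<in> disjoint_complement leq V (principal_band leq V u)"
proof -
  have "u \<in> disjoint_complement leq V {d}"
    using assms by (simp add: disjoint_complement_iff disjoint_sym)
  then have "principal_band leq V u \<subseteq> disjoint_complement leq V {d}"
    using band_disjoint_complement_singleton[of d] assms by (auto simp: principal_band_def)
  then show ?thesis
    using assms principal_band_closed[of u]
    by (auto simp: disjoint_complement_iff subset_iff intro: disjoint_sym)
qed


section \<open>Principal band projections\<close>

text \<open>The component of \<open>x\<close> in the band generated by \<open>u\<close> is \<open>b = sup (x \<sqinter> n u)\<close>, a supremum of a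
  sequence bounded by \<open>x\<close>. The ideal property turns the supremum taken in \<open>I\<close> into one in \<open>V\<close>.
  If \<open>w\<close> is a common lower bound of \<open>x - b\<close> and \<open>u\<close>, then \<open>(x \<sqinter> n u) + w \<preceq> x \<sqinter> (n + 1) u \<preceq> b\<close>
  for all \<open>n\<close>, so \<open>b - w\<close> is still an upper bound.\<close>

lemma principal_band_decomposition:
  assumes I: "order_ideal leq V I" "sigma_dedekind_complete leq I"
    and u: "u \<in> V" "0 \<preceq> u" and x: "x \<in> I" "0 \<preceq> x"
  obtains b d where "b \<in> principal_band leq V u"
    "d \<in> disjoint_complement leq V (principal_band leq V u)"
    "0 \<preceq> b" "0 \<preceq> d" "x = b + d"
proof -
  let ?B = "principal_band leq V u"
  define s where "s n = x \<sqinter>\<^sub>V (real n *\<^sub>R u)" for n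
  have IV: "I \<subseteq> V" and solid: "\<And>y z. \<lbrakk>y \<in> I; z \<in> V; modulus z \<preceq> modulus y\<rbrakk> \<Longrightarrow> z \<in> I"
    using I(1) by (auto simp: order_ideal_def)
  have xV: "x \<in> V" using x IV by blast
  have inI: "z \<in> I" if "z \<in> V" "0 \<preceq> z" "z \<preceq> x" for z
    using solid[of x z] that x xV by (simp add: modulus_of_nonneg)
  have nu: "0 \<preceq> real n *\<^sub>R u" for n
    using scale_mono[of 0 u "real n"] u by simp
  have sV [simp]: "s n \<in> V" for n using u xV by (simp add: s_def)
  have s_le: "s n \<preceq> x" "s n \<preceq> real n *\<^sub>R u" for n
    using u xV by (auto simp: s_def intro: meet_left meet_right)
  have s_nonneg: "0 \<preceq> s n" for n
    using u x xV nu by (auto simp: s_def intro: meet_greatest)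
  have sI: "range s \<subseteq> I" using inI s_le s_nonneg by auto
  have "x \<in> Upper (ord_on leq I) (range s)"
    using x s_le by (auto simp: Upper_def ord_on_def)
  then obtain b where "least (ord_on leq I) b (Upper (ord_on leq I) (range s))"
    using I(2) sI unfolding sigma_dedekind_complete_def
    by (metis countableI_type countable_image empty_iff empty_is_image UNIV_I)
  then have b: "b \<in> I" "\<And>n. s n \<preceq> b"
    and b_least: "\<And>z. \<lbrakk>z \<in> I; \<And>n. s n \<preceq> z\<rbrakk> \<Longrightarrow> b \<preceq> z"
    using sI by (auto simp: is_lub_iff)
  have bV: "b \<in> V" using b IV by blast
  have b_least_V: "b \<preceq> z" if z: "z \<in> V" "\<And>n. s n \<preceq> z" for z
  proof -
    have *: "s n \<preceq> z \<sqinter>\<^sub>V x" for n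
      using z xV s_le by (auto intro: meet_greatest)
    then have "0 \<preceq> z \<sqinter>\<^sub>V x"
      using z xV s_nonneg by (auto intro: leq_trans[of 0 "s 0"])
    then have "b \<preceq> z \<sqinter>\<^sub>V x"
      using z xV * by (auto intro!: b_least inI meet_right)
    then show ?thesis
      using z xV bV meet_left[of z x] by (auto intro: leq_trans[of b "z \<sqinter>\<^sub>V x"])
  qed
  have "s n \<in> ?B" for n
  proof -
    have "real n *\<^sub>R u \<in> ?B"
      using order_ideal_principal_band[OF u(1)] generator_in_principal_band[of u]
      by (auto simp: order_ideal_def intro: subspace_scale)
    moreover have "modulus (s n) \<preceq> modulus (real n *\<^sub>R u)"
      using s_le s_nonneg nu u by (simp add: modulus_of_nonneg)
    ultimately show ?thesis
      using order_ideal_principal_band[OF u(1)] unfolding order_ideal_def by (meson sV)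
  qed
  then have bB: "b \<in> ?B"
    using bV b b_least_V is_lub_iff[of "range s" V]
    by (intro principal_band_lub_closed[of "range s"]) (auto simp: image_subset_iff)
  have b_nonneg: "0 \<preceq> b"
    using b s_nonneg bV by (auto intro: leq_trans[of 0 "s 0"])
  have "b \<preceq> x" using s_le xV by (auto intro: b_least_V)
  then have d_nonneg: "0 \<preceq> x - b"
    by (rule leq_shift) (use xV bV in auto)
  have "x - b \<bottom>\<^sub>V u"
  proof (rule disjointI)
    fix w assume w: "w \<in> V" "w \<preceq> modulus (x - b)" "w \<preceq> modulus u"
    then have w: "w \<in> V" "w \<preceq> x - b" "w \<preceq> u"
      using u xV bV d_nonneg by (auto simp: modulus_of_nonneg)
    have "s n \<preceq> b - w" for n
    proof -
      have "s n + w \<preceq> b + (x - b)"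
        using b w xV bV by (intro add_mono) auto
      moreover have "s n + w \<preceq> real n *\<^sub>R u + u"
        using s_le w u by (intro add_mono) auto
      ultimately have "s n + w \<preceq> s (Suc n)"
        using w u xV by (auto simp: s_def[of "Suc n"] scaleR_add_left add.commute intro: meet_greatest)
      then have "s n + w \<preceq> b"
        using b w bV by (auto intro: leq_trans[of _ "s (Suc n)"])
      then show ?thesis by (rule leq_shift) (use w bV in auto)
    qed
    then have "b \<preceq> b - w" using w bV by (auto intro: b_least_V)
    then show "w \<preceq> 0" by (rule leq_shift) (use w bV in auto)
  qed (use u xV bV in auto)
  then have "x - b \<in> disjoint_complement leq V ?B"
    using u xV bV by (auto intro: disjoint_from_generator)
  then show thesis using that[of b "x - b"] bB b_nonneg d_nonneg by simp
qed

text \<open>A band projection is determined by its values on the two summands because an element of both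
  would be disjoint from itself.\<close>

lemma band_projection_eq:
  assumes P: "band_projection leq V B P" and B: "order_ideal leq V B"
    and bd: "b \<in> B" "d \<in> disjoint_complement leq V B"
  shows "P (b + d) = b"
proof -
  have BV: "B \<subseteq> V" and sB: "subspace B" using B by (auto simp: order_ideal_def)
  have sD: "subspace (disjoint_complement leq V B)"
    using BV by (rule subspace_disjoint_complement)
  have V: "b \<in> V" "d \<in> V" using BV bd by (auto simp: disjoint_complement_iff)
  let ?z = "P (b + d) - b"
  have P': "P (b + d) \<in> B" "b + d - P (b + d) \<in> disjoint_complement leq V B"
    using P V by (auto simp: band_projection_def)
  have z: "?z \<in> B" using P'(1) bd(1) by (rule subspace_diff[OF sB])
  have "d - (b + d - P (b + d)) \<in> disjoint_complement leq V B"
    using bd(2) P'(2) by (rule subspace_diff[OF sD])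
  then have "?z \<in> disjoint_complement leq V B" by simp
  then have "?z \<bottom>\<^sub>V ?z" "?z \<in> V" using z by (auto simp: disjoint_complement_iff)
  then have "?z = 0" by (rule disjoint_self_eq_0)
  then show ?thesis by simp
qed

text \<open>The operators with \<open>0 \<preceq> P \<preceq> I\<close>, a class that contains the band projections and is closed under
  \<open>P \<mapsto> I - P\<close>; these inequalities give \<open>|P x| \<preceq> |x|\<close>, the source of all norm estimates for
  projections below.\<close>

definition sub_identity :: "('a \<Rightarrow> 'a) \<Rightarrow> bool" where
  "sub_identity P \<longleftrightarrow> linear_op_on V P \<and> (\<forall>x\<in>V. P x \<in> V) \<and>
     (\<forall>x\<in>V. 0 \<preceq> x \<longrightarrow> 0 \<preceq> P x \<and> P x \<preceq> x)"

lemma linear_op_on_diff: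
  assumes "linear_op_on V S" "x \<in> V" "y \<in> V"
  shows "S (x - y) = S x - S y"
proof -
  have "S (x + (- 1) *\<^sub>R y) = S x + (- 1) *\<^sub>R S y"
    using assms scale_closed[of y "- 1"] unfolding linear_op_on_def by metis
  then show ?thesis by simp
qed

lemma sub_identity_complement:
  assumes "sub_identity P"
  shows "sub_identity (\<lambda>x. x - P x)"
  unfolding sub_identity_def
proof (intro conjI ballI impI)
  show "linear_op_on V (\<lambda>x. x - P x)"
    using assms by (auto simp: sub_identity_def linear_op_on_def algebra_simps)
  fix x assume x: "x \<in> V"
  show "x - P x \<in> V" using assms x by (auto simp: sub_identity_def)
  assume "0 \<preceq> x"
  then have P: "P x \<in> V" "0 \<preceq> P x" "P x \<preceq> x" using assms x by (auto simp: sub_identity_def)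
  show "0 \<preceq> x - P x" by (rule leq_shift[OF P(3)]) (use P x in auto)
  show "x - P x \<preceq> x" using P x by (auto intro: diff_le_self)
qed

lemma sub_identity_modulus_le:
  assumes P: "sub_identity P" and x: "x \<in> V"
  shows "modulus (P x) \<preceq> modulus x"
proof -
  have V: "P (pos x) \<in> V" "P (neg x) \<in> V" "P x \<in> V"
    and p: "0 \<preceq> P (pos x)" "P (pos x) \<preceq> pos x" and n: "0 \<preceq> P (neg x)" "P (neg x) \<preceq> neg x"
    using P x by (auto simp: sub_identity_def pos_nonneg neg_nonneg)
  have eq: "P x = P (pos x) - P (neg x)"
    using linear_op_on_diff[of P "pos x" "neg x"] P x by (simp add: sub_identity_def pos_minus_neg)
  have "P (pos x) \<preceq> modulus x"
    using leq_trans[OF p(2) pos_le_modulus] V x by simp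
  moreover have "P x \<preceq> P (pos x)" using V n by (simp add: eq diff_le_self)
  ultimately have 1: "P x \<preceq> modulus x"
    using V x by (auto intro: leq_trans[of _ "P (pos x)"])
  have "P (neg x) \<preceq> modulus x"
    using leq_trans[OF n(2) neg_le_modulus] V x by simp
  moreover have "- P x \<preceq> P (neg x)" using V p by (simp add: eq diff_le_self)
  ultimately have "- P x \<preceq> modulus x"
    using V x by (auto intro: leq_trans[of _ "P (neg x)"])
  then show ?thesis using 1 V x by (auto intro: modulus_least)
qed

text \<open>Splitting \<open>x = pos x - neg x\<close> extends the decomposition from the positive cone to \<open>V\<close>.
  Linearity and \<open>0 \<preceq> P \<preceq> I\<close> then follow from uniqueness of the decomposition.\<close>

lemma band_projection_exists:
  assumes B: "order_ideal leq V B"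
    and decomp: "\<And>x. \<lbrakk>x \<in> V; 0 \<preceq> x\<rbrakk> \<Longrightarrow>
      \<exists>b\<in>B. \<exists>d\<in>disjoint_complement leq V B. 0 \<preceq> b \<and> 0 \<preceq> d \<and> x = b + d"
  obtains P where "band_projection leq V B P" "sub_identity P"
proof -
  let ?D = "disjoint_complement leq V B"
  have BV: "B \<subseteq> V" and sB: "subspace B" using B by (auto simp: order_ideal_def)
  have sD: "subspace ?D" using BV by (rule subspace_disjoint_complement)
  have DV: "?D \<subseteq> V" by (auto simp: disjoint_complement_iff)
  have "\<exists>b. b \<in> B \<and> x - b \<in> ?D" if x: "x \<in> V" for x
  proof -
    obtain b d b' d' where bd: "b \<in> B" "d \<in> ?D" "pos x = b + d" "b' \<in> B" "d' \<in> ?D" "neg x = b' + d'"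
      using decomp[of "pos x"] decomp[of "neg x"] x pos_nonneg neg_nonneg by (metis pos_closed neg_closed)
    have "x - (b - b') = d - d'"
      using pos_minus_neg[OF x] bd(3,6) by (simp add: algebra_simps)
    then show ?thesis
      using subspace_diff[OF sB bd(1,4)] subspace_diff[OF sD bd(2,5)] by metis
  qed
  then obtain P where P: "\<And>x. x \<in> V \<Longrightarrow> P x \<in> B \<and> x - P x \<in> ?D" by metis
  then have proj: "band_projection leq V B P" by (simp add: band_projection_def)
  note eq = band_projection_eq[OF proj B]
  have "P (x + y) = P x + P y" if "x \<in> V" "y \<in> V" for x y
    using eq[of "P x + P y" "(x - P x) + (y - P y)"] P[of x] P[of y] that
      subspace_add[OF sB, of "P x" "P y"] subspace_add[OF sD, of "x - P x" "y - P y"]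
    by (simp add: algebra_simps)
  moreover have "P (c *\<^sub>R x) = c *\<^sub>R P x" if "x \<in> V" for c x
    using eq[of "c *\<^sub>R P x" "c *\<^sub>R (x - P x)"] P[of x] that
      subspace_scale[OF sB, of "P x" c] subspace_scale[OF sD, of "x - P x" c]
    by (simp add: algebra_simps)
  moreover have "0 \<preceq> P x \<and> P x \<preceq> x" if x: "x \<in> V" "0 \<preceq> x" for x
  proof -
    obtain b d where bd: "b \<in> B" "d \<in> ?D" "0 \<preceq> b" "0 \<preceq> d" "x = b + d"
      using decomp[OF x] by blast
    then have "P x = b" using eq by simp
    then show ?thesis using bd BV DV by (auto intro: le_add_nonneg)
  qed
  ultimately have "sub_identity P"
    using P BV by (auto simp: sub_identity_def linear_op_on_def)
  then show thesis using that proj by blast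
qed

lemma principal_band_projection_pos:
  assumes P: "band_projection leq V (principal_band leq V (pos f)) P" and f: "f \<in> V"
  shows "P f = pos f" "P (pos f) = pos f" "P (neg f) = 0"
proof -
  let ?B = "principal_band leq V (pos f)"
  have B: "order_ideal leq V ?B" using f by (simp add: order_ideal_principal_band)
  have p: "pos f \<in> ?B" by (rule generator_in_principal_band)
  have sD: "subspace (disjoint_complement leq V ?B)"
    using B by (simp add: order_ideal_def subspace_disjoint_complement)
  have n: "neg f \<in> disjoint_complement leq V ?B"
    using f by (auto intro!: disjoint_from_generator intro: disjoint_sym disjoint_pos_neg)
  note eq = band_projection_eq[OF P B]
  show "P f = pos f"
    using eq[OF p subspace_neg[OF sD n]] pos_minus_neg[OF f] by simp
  show "P (pos f) = pos f"
    using eq[OF p subspace_0[OF sD]] by simp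
  show "P (neg f) = 0"
    using eq[of 0, OF _ n] B by (simp add: order_ideal_def subspace_0)
qed


section \<open>Banach ideals\<close>

text \<open>Both the ideal property and the monotonicity of the norm are expressed through the modulus of
  the surrounding space \<open>V\<close>, which avoids the modulus of the smaller lattice altogether.\<close>

definition banach_ideal :: "'a nspace \<Rightarrow> bool" where
  "banach_ideal E \<longleftrightarrow> banach_space E \<and> points E \<subseteq> V \<and>
     (\<forall>x\<in>points E. \<forall>y\<in>V. modulus y \<preceq> modulus x \<longrightarrow> y \<in> points E \<and> nrm E y \<le> nrm E x)"

text \<open>The modulus of \<open>x\<close> formed in \<open>V\<close> belongs to the ideal, hence is also the supremum of \<open>x\<close> and
  \<open>- x\<close> there.\<close>

lemma banach_lattice_order_ideal:
  assumes E: "banach_lattice leq E" and ideal: "order_ideal leq V (points E)"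
  shows "banach_ideal E"
proof -
  interpret E: riesz_space leq "points E"
    using E by unfold_locales (simp add: banach_lattice_def)
  have EV: "points E \<subseteq> V" and solid: "\<And>x y. \<lbrakk>x \<in> points E; y \<in> V; modulus y \<preceq> modulus x\<rbrakk> \<Longrightarrow> y \<in> points E"
    using ideal by (auto simp: order_ideal_def)
  have modulus_eq: "E.modulus x = modulus x" if x: "x \<in> points E" for x
  proof (rule leq_antisym)
    have xV: "x \<in> V" using x EV by blast
    have "modulus x \<in> points E"
      using xV by (intro solid[OF x]) (auto simp: modulus_of_nonneg modulus_nonneg)
    then show "E.modulus x \<preceq> modulus x"
      using x xV by (auto intro: E.modulus_least le_modulus minus_le_modulus)
    show "modulus x \<preceq> E.modulus x"
      using x xV EV E.modulus_closed[OF x]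
      by (intro modulus_least E.le_modulus E.minus_le_modulus) auto
    show "E.modulus x \<in> V" "modulus x \<in> V" using x xV EV E.modulus_closed[OF x] by auto
  qed
  show ?thesis
    unfolding banach_ideal_def
    using E EV solid by (simp add: banach_lattice_def modulus_eq)
qed

lemma banach_idealD:
  assumes "banach_ideal E" "x \<in> points E" "y \<in> V" "modulus y \<preceq> modulus x"
  shows "y \<in> points E" "nrm E y \<le> nrm E x"
  using assms by (auto simp: banach_ideal_def)

end


section \<open>Operator norms\<close>

lemma banach_spaceD:
  assumes "banach_space E"
  shows "subspace (points E)"
    and "x \<in> points E \<Longrightarrow> 0 \<le> nrm E x"
    and "x \<in> points E \<Longrightarrow> nrm E x = 0 \<longleftrightarrow> x = 0"
    and "x \<in> points E \<Longrightarrow> nrm E (c *\<^sub>R x) = \<bar>c\<bar> * nrm E x"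
    and "nrm E 0 = 0"
proof -
  show sub: "subspace (points E)" using assms by (simp add: banach_space_def)
  show "x \<in> points E \<Longrightarrow> 0 \<le> nrm E x" "x \<in> points E \<Longrightarrow> nrm E x = 0 \<longleftrightarrow> x = 0"
    "x \<in> points E \<Longrightarrow> nrm E (c *\<^sub>R x) = \<bar>c\<bar> * nrm E x"
    using assms by (simp_all add: banach_space_def)
  show "nrm E 0 = 0" using assms subspace_0[OF sub] by (simp add: banach_space_def)
qed

lemma op_norm_le:
  assumes "0 \<in> points E" "nrm E 0 \<le> 1" "0 \<le> c"
    and "\<And>x. x \<in> points E \<Longrightarrow> nrm F (S x) \<le> c * nrm E x"
  shows "op_norm E F S \<le> c"
  unfolding op_norm_def
proof (rule cSup_least)
  show "{nrm F (S x) |x. x \<in> points E \<and> nrm E x \<le> 1} \<noteq> {}" using assms by blast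
  fix r assume "r \<in> {nrm F (S x) |x. x \<in> points E \<and> nrm E x \<le> 1}"
  then obtain x where x: "r = nrm F (S x)" "x \<in> points E" "nrm E x \<le> 1" by blast
  then have "r \<le> c * nrm E x" using assms by simp
  also have "\<dots> \<le> c" using x assms by (simp add: mult_left_le)
  finally show "r \<le> c" .
qed

lemma nrm_le_op_norm_unit:
  assumes "bounded_op E F S" "x \<in> points E" "nrm E x \<le> 1"
    and nonneg: "\<And>x. x \<in> points E \<Longrightarrow> 0 \<le> nrm E x"
  shows "nrm F (S x) \<le> op_norm E F S"
  unfolding op_norm_def
proof (rule cSup_upper)
  obtain C where C: "\<And>x. x \<in> points E \<Longrightarrow> nrm F (S x) \<le> C * nrm E x"
    using assms by (auto simp: bounded_op_def)
  show "bdd_above {nrm F (S x) |x. x \<in> points E \<and> nrm E x \<le> 1}"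
  proof (rule bdd_aboveI)
    fix r assume "r \<in> {nrm F (S x) |x. x \<in> points E \<and> nrm E x \<le> 1}"
    then obtain x where x: "r = nrm F (S x)" "x \<in> points E" "nrm E x \<le> 1" by blast
    then have "r \<le> C * nrm E x" using C by simp
    also have "\<dots> \<le> \<bar>C\<bar> * nrm E x"
      using x nonneg by (simp add: mult_right_mono)
    also have "\<dots> \<le> \<bar>C\<bar>" using x by (simp add: mult_left_le)
    finally show "r \<le> \<bar>C\<bar>" .
  qed
qed (use assms in blast)

lemma op_norm_nonneg:
  assumes "bounded_op E F S" "banach_space E" "banach_space F"
  shows "0 \<le> op_norm E F S"
proof -
  have 0: "0 \<in> points E" "nrm E 0 \<le> 1"
    using subspace_0[OF banach_spaceD(1)[OF assms(2)]] banach_spaceD(5)[OF assms(2)] by simp_all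
  have "0 \<le> nrm F (S 0)"
    using 0 assms by (auto simp: bounded_op_def intro: banach_spaceD(2))
  also have "\<dots> \<le> op_norm E F S" using assms(1) 0 banach_spaceD(2)[OF assms(2)] by (rule nrm_le_op_norm_unit)
  finally show ?thesis .
qed

lemma nrm_le_op_norm:
  assumes S: "bounded_op E F S" and E: "banach_space E" and F: "banach_space F"
    and hom: "\<And>c x. x \<in> points E \<Longrightarrow> S (c *\<^sub>R x) = c *\<^sub>R S x" and x: "x \<in> points E"
  shows "nrm F (S x) \<le> op_norm E F S * nrm E x"
proof (cases "x = 0")
  case True
  then show ?thesis
    using hom[OF x, of 0] banach_spaceD(5)[OF E] banach_spaceD(5)[OF F] by simp
next
  case False
  let ?y = "(1 / nrm E x) *\<^sub>R x"
  have pos: "nrm E x > 0"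
    using False x banach_spaceD(2,3)[OF E x] by linarith
  have "?y \<in> points E" "nrm E ?y \<le> 1"
    using pos x banach_spaceD(4)[OF E x] subspace_scale[OF banach_spaceD(1)[OF E]] by auto
  then have "nrm F (S ?y) \<le> op_norm E F S" using banach_spaceD(2)[OF E] by (rule nrm_le_op_norm_unit[OF S])
  moreover have "S x \<in> points F" using S x by (auto simp: bounded_op_def)
  ultimately show ?thesis
    using pos hom[OF x] banach_spaceD(4)[OF F] by (simp add: field_simps)
qed


section \<open>The K-functional on couples of Banach ideals\<close>

locale lattice_couple = riesz_space leq "points (sum_space X)"
  for leq :: "'a::real_vector \<Rightarrow> 'a \<Rightarrow> bool" (infix "\<preceq>" 50) and X :: "'a couple" +
  assumes ideal0: "banach_ideal (cpl0 X)" and ideal1: "banach_ideal (cpl1 X)"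
begin

abbreviation "V \<equiv> points (sum_space X)"
abbreviation "X0 \<equiv> points (cpl0 X)"
abbreviation "X1 \<equiv> points (cpl1 X)"

lemma V_iff: "f \<in> V \<longleftrightarrow> (\<exists>f0\<in>X0. \<exists>f1\<in>X1. f = f0 + f1)"
  by (auto simp: sum_space_def)

lemma banach0: "banach_space (cpl0 X)" and banach1: "banach_space (cpl1 X)"
  and X0_V: "X0 \<subseteq> V" and X1_V: "X1 \<subseteq> V"
  using ideal0 ideal1 by (auto simp: banach_ideal_def)

text \<open>The Riesz decomposition of \<open>g\<close> along \<open>|f0| + |f1|\<close> has summands dominated by \<open>|f0|\<close> and \<open>|f1|\<close>,
  which therefore lie in the ideals \<open>X0\<close> and \<open>X1\<close> with no larger norm.\<close>

lemma positive_splitting: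
  assumes g: "g \<in> V" "0 \<preceq> g" "g \<preceq> f0 + f1" and f: "f0 \<in> X0" "f1 \<in> X1"
  obtains g0 g1 where "g0 \<in> X0" "g1 \<in> X1" "g = g0 + g1" "0 \<preceq> g0" "0 \<preceq> g1"
    "nrm (cpl0 X) g0 \<le> nrm (cpl0 X) f0" "nrm (cpl1 X) g1 \<le> nrm (cpl1 X) f1"
proof -
  have V: "f0 \<in> V" "f1 \<in> V" using f X0_V X1_V by auto
  have "f0 + f1 \<preceq> modulus f0 + modulus f1"
    using V by (intro add_mono le_modulus) auto
  then have "g \<preceq> modulus f0 + modulus f1"
    using g V by (auto intro: leq_trans[of g "f0 + f1"])
  then obtain g0 g1 where d: "g0 \<in> V" "g1 \<in> V" "g = g0 + g1"
      "0 \<preceq> g0" "g0 \<preceq> modulus f0" "0 \<preceq> g1" "g1 \<preceq> modulus f1"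
    using riesz_decomposition[of g "modulus f0" "modulus f1"] g V modulus_nonneg by auto
  then show thesis
    using that[of g0 g1] banach_idealD[OF ideal0 f(1), of g0] banach_idealD[OF ideal1 f(2), of g1]
    by (simp add: modulus_of_nonneg)
qed

lemma K_le:
  assumes "f0 \<in> X0" "f1 \<in> X1" "t > 0"
  shows "K_functional X (f0 + f1) t \<le> nrm (cpl0 X) f0 + t * nrm (cpl1 X) f1"
  unfolding K_functional_def
proof (rule cInf_lower)
  show "bdd_below {nrm (cpl0 X) g0 + t * nrm (cpl1 X) g1 |g0 g1.
      g0 \<in> X0 \<and> g1 \<in> X1 \<and> f0 + f1 = g0 + g1}"
    using assms banach_spaceD(2)[OF banach0] banach_spaceD(2)[OF banach1]
    by (intro bdd_belowI[of _ 0]) auto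
qed (use assms in blast)

lemma le_K:
  assumes "f \<in> V"
    and "\<And>f0 f1. \<lbrakk>f0 \<in> X0; f1 \<in> X1; f = f0 + f1\<rbrakk> \<Longrightarrow> c \<le> nrm (cpl0 X) f0 + t * nrm (cpl1 X) f1"
  shows "c \<le> K_functional X f t"
  unfolding K_functional_def
  by (rule cInf_greatest) (use assms in \<open>auto simp: V_iff\<close>)

lemma K_mono:
  assumes g: "g \<in> V" "0 \<preceq> g" "g \<preceq> h" and h: "h \<in> V" and t: "t > 0"
  shows "K_functional X g t \<le> K_functional X h t"
proof (rule le_K[OF h])
  fix f0 f1 assume f: "f0 \<in> X0" "f1 \<in> X1" "h = f0 + f1"
  then obtain g0 g1 where d: "g0 \<in> X0" "g1 \<in> X1" "g = g0 + g1"
    "nrm (cpl0 X) g0 \<le> nrm (cpl0 X) f0" "nrm (cpl1 X) g1 \<le> nrm (cpl1 X) f1"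
    using positive_splitting[of g f0 f1] g by metis
  have "K_functional X g t \<le> nrm (cpl0 X) g0 + t * nrm (cpl1 X) g1"
    using K_le[OF d(1,2) t] d(3) by simp
  also have "\<dots> \<le> nrm (cpl0 X) f0 + t * nrm (cpl1 X) f1"
    using d t by (simp add: add_mono_thms_linordered_semiring(1))
  finally show "K_functional X g t \<le> nrm (cpl0 X) f0 + t * nrm (cpl1 X) f1" .
qed

text \<open>The pointwise form of membership in the unit ball of \<open>L\<^sup>+(X)\<close>; it avoids the supremum in the
  operator norm.\<close>

definition positive_contraction :: "('a \<Rightarrow> 'a) \<Rightarrow> bool" where
  "positive_contraction R \<longleftrightarrow> linear_op_on V R \<and>
     (\<forall>x\<in>X0. R x \<in> X0 \<and> nrm (cpl0 X) (R x) \<le> nrm (cpl0 X) x) \<and>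
     (\<forall>x\<in>X1. R x \<in> X1 \<and> nrm (cpl1 X) (R x) \<le> nrm (cpl1 X) x) \<and>
     (\<forall>x\<in>V. 0 \<preceq> x \<longrightarrow> 0 \<preceq> R x)"

lemma positive_contraction_split:
  assumes "positive_contraction R" "f0 \<in> X0" "f1 \<in> X1"
  shows "R (f0 + f1) = R f0 + R f1" "R f0 \<in> X0" "R f1 \<in> X1"
  using assms X0_V X1_V by (auto simp: positive_contraction_def linear_op_on_def)

lemma positive_contraction_closed:
  assumes "positive_contraction R" "f \<in> V"
  shows "R f \<in> V"
  using assms positive_contraction_split[OF assms(1)] by (metis V_iff)

lemma K_positive_contraction:
  assumes R: "positive_contraction R" and f: "f \<in> V" and t: "t > 0"
  shows "K_functional X (R f) t \<le> K_functional X f t"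
proof (rule le_K[OF f])
  fix f0 f1 assume d: "f0 \<in> X0" "f1 \<in> X1" "f = f0 + f1"
  note s = positive_contraction_split[OF R d(1,2)]
  have "K_functional X (R f) t \<le> nrm (cpl0 X) (R f0) + t * nrm (cpl1 X) (R f1)"
    using K_le[OF s(2,3) t] s(1) d(3) by simp
  also have "\<dots> \<le> nrm (cpl0 X) f0 + t * nrm (cpl1 X) f1"
    using d t R by (auto simp: positive_contraction_def intro!: add_mono_thms_linordered_semiring(1))
  finally show "K_functional X (R f) t \<le> nrm (cpl0 X) f0 + t * nrm (cpl1 X) f1" .
qed

text \<open>The elements \<open>R (pos f)\<close> and \<open>R (neg f)\<close> are positive and their difference is \<open>R f\<close>, so they
  dominate the positive and negative parts of \<open>R f\<close>.\<close>

lemma K_dominated_positive_contraction: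
  assumes R: "positive_contraction R" and f: "f \<in> V"
  shows "K_dominated leq X (R f) f"
proof -
  have cl: "R x \<in> V" if "x \<in> V" for x
    using R that by (rule positive_contraction_closed)
  have nonneg: "0 \<preceq> R x" if "x \<in> V" "0 \<preceq> x" for x
    using R that by (simp add: positive_contraction_def)
  have eq: "R f = R (pos f) - R (neg f)"
    using linear_op_on_diff[of R "pos f" "neg f"] R f pos_minus_neg[OF f]
    by (simp add: positive_contraction_def)
  have "R f \<preceq> R (pos f)" "- R f \<preceq> R (neg f)"
    using f cl nonneg by (auto simp: eq pos_nonneg neg_nonneg intro!: diff_le_self)
  then have p: "pos (R f) \<preceq> R (pos f)" and n: "neg (R f) \<preceq> R (neg f)"
    using f cl nonneg pos_nonneg[OF f] neg_nonneg[OF f]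
    by (auto simp: neg_eq_pos_minus[of "R f"] intro!: pos_least)
  have "K_functional X (pos (R f)) t \<le> K_functional X (pos f) t"
    "K_functional X (neg (R f)) t \<le> K_functional X (neg f) t" if t: "t > 0" for t
    using K_mono[OF _ _ p _ t] K_mono[OF _ _ n _ t] f cl
      K_positive_contraction[OF R _ t, of "pos f"] K_positive_contraction[OF R _ t, of "neg f"]
    by (auto simp: pos_nonneg neg_nonneg intro: order_trans)
  then show ?thesis by (simp add: K_dominated_def)
qed

lemma positive_couple_opsD:
  assumes "S \<in> positive_couple_ops leq X leq X"
  shows "linear_op_on V S" "\<And>x. \<lbrakk>x \<in> V; 0 \<preceq> x\<rbrakk> \<Longrightarrow> 0 \<preceq> S x" "0 \<le> couple_norm X X S"
    and "\<And>x. x \<in> X0 \<Longrightarrow> S x \<in> X0 \<and> nrm (cpl0 X) (S x) \<le> couple_norm X X S * nrm (cpl0 X) x"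
    and "\<And>x. x \<in> X1 \<Longrightarrow> S x \<in> X1 \<and> nrm (cpl1 X) (S x) \<le> couple_norm X X S * nrm (cpl1 X) x"
proof -
  show lin: "linear_op_on V S" and "\<And>x. \<lbrakk>x \<in> V; 0 \<preceq> x\<rbrakk> \<Longrightarrow> 0 \<preceq> S x"
    using assms by (auto simp: positive_couple_ops_def couple_ops_def)
  have b0: "bounded_op (cpl0 X) (cpl0 X) S" and b1: "bounded_op (cpl1 X) (cpl1 X) S"
    using assms by (auto simp: positive_couple_ops_def couple_ops_def)
  show "0 \<le> couple_norm X X S"
    using op_norm_nonneg[OF b0 banach0 banach0] by (simp add: couple_norm_def)
  have hom: "S (c *\<^sub>R x) = c *\<^sub>R S x" if "x \<in> V" for c x
    using lin that by (simp add: linear_op_on_def)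
  fix x
  show "S x \<in> X0 \<and> nrm (cpl0 X) (S x) \<le> couple_norm X X S * nrm (cpl0 X) x" if x: "x \<in> X0"
  proof
    show "S x \<in> X0" using b0 x by (auto simp: bounded_op_def)
    have "nrm (cpl0 X) (S x) \<le> op_norm (cpl0 X) (cpl0 X) S * nrm (cpl0 X) x"
      by (rule nrm_le_op_norm[OF b0 banach0 banach0 _ x]) (use hom X0_V in auto)
    also have "\<dots> \<le> couple_norm X X S * nrm (cpl0 X) x"
      using banach_spaceD(2)[OF banach0 x] by (simp add: couple_norm_def mult_right_mono)
    finally show "nrm (cpl0 X) (S x) \<le> couple_norm X X S * nrm (cpl0 X) x" .
  qed
  show "S x \<in> X1 \<and> nrm (cpl1 X) (S x) \<le> couple_norm X X S * nrm (cpl1 X) x" if x: "x \<in> X1"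
  proof
    show "S x \<in> X1" using b1 x by (auto simp: bounded_op_def)
    have "nrm (cpl1 X) (S x) \<le> op_norm (cpl1 X) (cpl1 X) S * nrm (cpl1 X) x"
      by (rule nrm_le_op_norm[OF b1 banach1 banach1 _ x]) (use hom X1_V in auto)
    also have "\<dots> \<le> couple_norm X X S * nrm (cpl1 X) x"
      using banach_spaceD(2)[OF banach1 x] by (simp add: couple_norm_def mult_right_mono)
    finally show "nrm (cpl1 X) (S x) \<le> couple_norm X X S * nrm (cpl1 X) x" .
  qed
qed

lemma positive_contraction_scaled:
  assumes S: "S \<in> positive_couple_ops leq X leq X" and c: "couple_norm X X S \<le> c" "0 < c"
  shows "positive_contraction (\<lambda>x. (1/c) *\<^sub>R S x)"
proof -
  note D = positive_couple_opsD[OF S]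
  have bound: "(1/c) *\<^sub>R S x \<in> points E \<and> nrm E ((1/c) *\<^sub>R S x) \<le> nrm E x"
    if E: "banach_space E" and x: "x \<in> points E"
      and Sx: "S x \<in> points E \<and> nrm E (S x) \<le> couple_norm X X S * nrm E x" for E x
  proof -
    have "couple_norm X X S * nrm E x \<le> c * nrm E x"
      using c banach_spaceD(2)[OF E x] by (simp add: mult_right_mono)
    then have "nrm E (S x) \<le> c * nrm E x" using Sx by linarith
    then have "nrm E (S x) / c \<le> nrm E x" using c by (simp add: divide_le_eq mult.commute)
    moreover have "nrm E ((1/c) *\<^sub>R S x) = nrm E (S x) / c"
      using c Sx banach_spaceD(4)[OF E, of "S x" "1/c"] by simp
    ultimately show ?thesis
      using Sx subspace_scale[OF banach_spaceD(1)[OF E]] by simp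
  qed
  have "S x \<in> V" if "x \<in> V" for x
    using that D(1,4,5) X0_V X1_V by (auto simp: V_iff linear_op_on_def) (meson subset_iff)
  then have "0 \<preceq> (1/c) *\<^sub>R S x" if "x \<in> V" "0 \<preceq> x" for x
    using scale_mono[of 0 "S x" "1/c"] D(2) c that by simp
  moreover have "linear_op_on V (\<lambda>x. (1/c) *\<^sub>R S x)"
    using D(1) by (auto simp: linear_op_on_def scaleR_add_right)
  ultimately show ?thesis
    using bound[OF banach0] bound[OF banach1] D(4,5) by (simp add: positive_contraction_def)
qed


section \<open>Monotone spaces are interpolation spaces\<close>

lemma intermediate_spaceD:
  assumes "intermediate_space X E"
  shows "banach_space E" "points E \<subseteq> V"
  using assms unfolding intermediate_space_def continuously_embedded_def by blast+

text \<open>An operator of norm \<open>0\<close> cannot be normalised, but it vanishes on \<open>X0\<close> and \<open>X1\<close> and hence on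
  \<open>V\<close>.\<close>

theorem K_monotone_imp_interpolation:
  assumes E: "exactly_partially_K_monotone leq X E"
  shows "exact_interpolation_space_positive leq X E"
  unfolding exact_interpolation_space_positive_def
proof (intro conjI ballI)
  show int: "intermediate_space X E" using E by (simp add: exactly_partially_K_monotone_def)
  note banach = intermediate_spaceD(1)[OF int] and EV = intermediate_spaceD(2)[OF int]
  fix S assume S: "S \<in> positive_couple_ops leq X leq X"
  let ?c = "couple_norm X X S"
  note D = positive_couple_opsD[OF S]
  have bound: "S f \<in> points E \<and> nrm E (S f) \<le> ?c * nrm E f" if f: "f \<in> points E" for f
  proof (cases "?c = 0")
    case True
    obtain f0 f1 where d: "f0 \<in> X0" "f1 \<in> X1" "f = f0 + f1"
      using subsetD[OF EV f] unfolding V_iff by blast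
    have "S f0 \<in> X0" "nrm (cpl0 X) (S f0) \<le> 0" "S f1 \<in> X1" "nrm (cpl1 X) (S f1) \<le> 0"
      using D(4)[OF d(1)] D(5)[OF d(2)] True by simp_all
    then have "S f0 = 0" "S f1 = 0"
      using banach_spaceD(2,3)[OF banach0, of "S f0"] banach_spaceD(2,3)[OF banach1, of "S f1"]
      by simp_all
    moreover have "S (f0 + f1) = S f0 + S f1"
      using subsetD[OF X0_V d(1)] subsetD[OF X1_V d(2)] D(1) by (simp add: linear_op_on_def)
    ultimately have "S f = 0" using d by simp
    then show ?thesis using True banach_spaceD(1,5)[OF banach] by (simp add: subspace_0)
  next
    case False
    then have c: "0 < ?c" using D(3) by simp
    let ?R = "\<lambda>x. (1 / ?c) *\<^sub>R S x"
    have R: "positive_contraction ?R" using S c by (simp add: positive_contraction_scaled)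
    have fV: "f \<in> V" using f EV by blast
    have g: "?R f \<in> points E" "nrm E (?R f) \<le> nrm E f"
      using E f positive_contraction_closed[OF R fV] K_dominated_positive_contraction[OF R fV]
      by (simp_all add: exactly_partially_K_monotone_def)
    define h where "h = ?R f"
    have h: "S f = ?c *\<^sub>R h" "h \<in> points E" "nrm E h \<le> nrm E f"
      using c g by (simp_all add: h_def)
    have "nrm E (?c *\<^sub>R h) = \<bar>?c\<bar> * nrm E h" by (rule banach_spaceD(4)[OF banach h(2)])
    also have "\<dots> \<le> ?c * nrm E f"
      using h(3) c by (simp add: mult_left_mono)
    finally show ?thesis
      using h subspace_scale[OF banach_spaceD(1)[OF banach] h(2)] by simp
  qed
  then show "bounded_op E E S" unfolding bounded_op_def by blast
  show "op_norm E E S \<le> ?c"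
    by (rule op_norm_le)
      (use bound D(3) subspace_0[OF banach_spaceD(1)[OF banach]] banach_spaceD(5)[OF banach] in simp_all)
qed


section \<open>Interpolation spaces are monotone\<close>

text \<open>A positive \<open>x\<close> is the sum of positive elements of \<open>X0\<close> and \<open>X1\<close>; their components in the
  band and in its disjoint complement are added separately.\<close>

lemma principal_band_projection_exists:
  assumes sigma: "sigma_dedekind_complete leq X0" "sigma_dedekind_complete leq X1"
    and ideals: "order_ideal leq V X0" "order_ideal leq V X1"
    and u: "u \<in> V" "0 \<preceq> u"
  obtains P where "band_projection leq V (principal_band leq V u) P" "sub_identity P"
proof -
  let ?B = "principal_band leq V u"
  let ?D = "disjoint_complement leq V ?B"
  have B: "order_ideal leq V ?B" using u by (simp add: order_ideal_principal_band)
  then have sB: "subspace ?B" and BV: "?B \<subseteq> V" by (auto simp: order_ideal_def)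
  have sD: "subspace ?D" using BV by (rule subspace_disjoint_complement)
  have DV: "?D \<subseteq> V" by (auto simp: disjoint_complement_iff)
  have "\<exists>b\<in>?B. \<exists>d\<in>?D. 0 \<preceq> b \<and> 0 \<preceq> d \<and> x = b + d" if x: "x \<in> V" "0 \<preceq> x" for x
  proof -
    obtain f0 f1 where f: "f0 \<in> X0" "f1 \<in> X1" "x = f0 + f1" using x V_iff by blast
    have "x \<preceq> f0 + f1" using f x by simp
    then obtain x0 x1 where xs: "x0 \<in> X0" "x1 \<in> X1" "x = x0 + x1" "0 \<preceq> x0" "0 \<preceq> x1"
      using positive_splitting[OF x _ f(1,2)] by metis
    obtain b0 d0 where 0: "b0 \<in> ?B" "d0 \<in> ?D" "0 \<preceq> b0" "0 \<preceq> d0" "x0 = b0 + d0"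
      using principal_band_decomposition[OF ideals(1) sigma(1) u xs(1,4)] .
    obtain b1 d1 where 1: "b1 \<in> ?B" "d1 \<in> ?D" "0 \<preceq> b1" "0 \<preceq> d1" "x1 = b1 + d1"
      using principal_band_decomposition[OF ideals(2) sigma(2) u xs(2,5)] .
    have nonneg: "0 \<preceq> y + z" if "0 \<preceq> y" "0 \<preceq> z" "y \<in> V" "z \<in> V" for y z
      using add_mono[of 0 y 0 z] that by simp
    show ?thesis
    proof (intro bexI conjI)
      show "b0 + b1 \<in> ?B" using 0(1) 1(1) by (rule subspace_add[OF sB])
      show "d0 + d1 \<in> ?D" using 0(2) 1(2) by (rule subspace_add[OF sD])
      show "0 \<preceq> b0 + b1" "0 \<preceq> d0 + d1" using 0 1 BV DV by (auto intro!: nonneg)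
      show "x = (b0 + b1) + (d0 + d1)" using xs 0 1 by simp
    qed
  qed
  then show thesis using band_projection_exists[OF B] that by blast
qed

lemma positive_contraction_sub_identity:
  assumes P: "sub_identity P"
  shows "positive_contraction P"
proof -
  have bound: "P x \<in> points E \<and> nrm E (P x) \<le> nrm E x"
    if E: "banach_ideal E" and x: "x \<in> points E" for E x
  proof -
    have xV: "x \<in> V" using E x by (auto simp: banach_ideal_def)
    then have "P x \<in> V" using P by (simp add: sub_identity_def)
    then show ?thesis
      using banach_idealD[OF E x _ sub_identity_modulus_le[OF P xV]] by simp
  qed
  show ?thesis
    using P bound[OF ideal0] bound[OF ideal1]
    by (simp add: positive_contraction_def sub_identity_def)
qed

lemma positive_contraction_imp_positive_couple_ops:
  assumes R: "positive_contraction R"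
  shows "R \<in> positive_couple_ops leq X leq X"
proof -
  have "bounded_op (cpl0 X) (cpl0 X) R" "bounded_op (cpl1 X) (cpl1 X) R"
    using R unfolding bounded_op_def positive_contraction_def
    by (auto intro: exI[of _ "1::real"])
  then show ?thesis
    using R by (simp add: positive_couple_ops_def couple_ops_def positive_contraction_def)
qed

text \<open>The image couples carry the norms of \<open>X0\<close> and \<open>X1\<close>, and \<open>P\<close> maps each of these spaces into
  itself, so restricting to the range of \<open>P\<close> and following by \<open>Q\<close> do not increase the norm.\<close>

lemma compression_contraction:
  assumes R: "positive_contraction R" and P: "sub_identity P" and Q: "sub_identity Q"
  shows "(\<lambda>x. Q (R x)) \<in> positive_couple_ops leq (image_couple P X) leq (image_couple Q X)"
    and "contraction (image_couple P X) (image_couple Q X) (\<lambda>x. Q (R x))"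
proof -
  let ?S = "\<lambda>x. Q (R x)" and ?PX = "image_couple P X" and ?QX = "image_couple Q X"
  note cP = positive_contraction_sub_identity[OF P] and cQ = positive_contraction_sub_identity[OF Q]
  have linP: "linear_op_on V P" using P by (simp add: sub_identity_def)
  have P0: "P ` X0 \<subseteq> X0" and P1: "P ` X1 \<subseteq> X1" using cP by (auto simp: positive_contraction_def)
  have PV: "points (sum_space ?PX) \<subseteq> V"
  proof
    fix x assume "x \<in> points (sum_space ?PX)"
    then obtain x0 x1 where "x0 \<in> P ` X0" "x1 \<in> P ` X1" "x = x0 + x1"
      by (simp add: sum_space_def image_couple_def) metis
    then show "x \<in> V" using P0 P1 V_iff by (metis subsetD)
  qed
  have V: "R x \<in> V" "Q (R x) \<in> V" if "x \<in> V" for x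
    using positive_contraction_closed[OF R] positive_contraction_closed[OF cQ] that by auto
  have "linear_op_on V ?S"
    using R Q V by (auto simp: positive_contraction_def sub_identity_def linear_op_on_def)
  then have lin: "linear_op_on (points (sum_space ?PX)) ?S"
    using PV unfolding linear_op_on_def by blast
  have n0: "nrm (cpl0 X) (?S x) \<le> nrm (cpl0 X) x \<and> ?S x \<in> Q ` X0" if "x \<in> P ` X0" for x
  proof -
    have "x \<in> X0" using that P0 by blast
    then have "R x \<in> X0" "nrm (cpl0 X) (R x) \<le> nrm (cpl0 X) x"
      using R by (simp_all add: positive_contraction_def)
    moreover from this have "nrm (cpl0 X) (?S x) \<le> nrm (cpl0 X) (R x)"
      using cQ by (simp add: positive_contraction_def)
    ultimately show ?thesis by simp
  qed
  have n1: "nrm (cpl1 X) (?S x) \<le> nrm (cpl1 X) x \<and> ?S x \<in> Q ` X1" if "x \<in> P ` X1" for x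
  proof -
    have "x \<in> X1" using that P1 by blast
    then have "R x \<in> X1" "nrm (cpl1 X) (R x) \<le> nrm (cpl1 X) x"
      using R by (simp_all add: positive_contraction_def)
    moreover from this have "nrm (cpl1 X) (?S x) \<le> nrm (cpl1 X) (R x)"
      using cQ by (simp add: positive_contraction_def)
    ultimately show ?thesis by simp
  qed
  have "bounded_op (cpl0 ?PX) (cpl0 ?QX) ?S" "bounded_op (cpl1 ?PX) (cpl1 ?QX) ?S"
    using n0 n1 unfolding bounded_op_def image_couple_def
    by (auto intro!: exI[of _ "1::real"])
  then have ops: "?S \<in> couple_ops ?PX ?QX" using lin by (simp add: couple_ops_def)
  have "0 \<preceq> ?S x" if "x \<in> points (sum_space ?PX)" "0 \<preceq> x" for x
    using that PV R cQ V unfolding positive_contraction_def by blast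
  then show "?S \<in> positive_couple_ops leq ?PX leq ?QX"
    using ops by (simp add: positive_couple_ops_def)
  have "P 0 = 0" using linear_op_on_diff[OF linP, of 0 0] by simp
  then have 0: "0 \<in> P ` X0" "0 \<in> P ` X1"
    using subspace_0[OF banach_spaceD(1)[OF banach0]] subspace_0[OF banach_spaceD(1)[OF banach1]]
    by (metis imageI)+
  have "op_norm (cpl0 ?PX) (cpl0 ?QX) ?S \<le> 1"
    by (rule op_norm_le) (use 0 n0 banach_spaceD(5)[OF banach0] in \<open>auto simp: image_couple_def\<close>)
  moreover have "op_norm (cpl1 ?PX) (cpl1 ?QX) ?S \<le> 1"
    by (rule op_norm_le) (use 0 n1 banach_spaceD(5)[OF banach1] in \<open>auto simp: image_couple_def\<close>)
  ultimately show "contraction ?PX ?QX ?S"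
    using ops by (simp add: contraction_def couple_norm_def)
qed

lemma exact_interpolation_contraction:
  assumes E: "exact_interpolation_space_positive leq X E"
    and T: "T \<in> positive_couple_ops leq X leq X" "couple_norm X X T \<le> 1" and f: "f \<in> points E"
  shows "T f \<in> points E" "nrm E (T f) \<le> nrm E f"
proof -
  have int: "intermediate_space X E" and b: "bounded_op E E T" and n: "op_norm E E T \<le> 1"
    using E T by (auto simp: exact_interpolation_space_positive_def intro: order_trans)
  note banach = intermediate_spaceD(1)[OF int] and EV = intermediate_spaceD(2)[OF int]
  show "T f \<in> points E" using b f by (auto simp: bounded_op_def)
  have "nrm E (T f) \<le> op_norm E E T * nrm E f"
    by (rule nrm_le_op_norm[OF b banach banach _ f])
      (use EV positive_couple_opsD(1)[OF T(1)] in \<open>auto simp: linear_op_on_def\<close>)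
  also have "\<dots> \<le> nrm E f"
    using mult_right_mono[OF n banach_spaceD(2)[OF banach f]] by simp
  finally show "nrm E (T f) \<le> nrm E f" .
qed

text \<open>The operators that carry the positive and the negative part of \<open>f\<close> to those of \<open>g\<close> are combined
  into one by means of the band projections of \<open>pos f\<close> and \<open>pos g\<close>.\<close>

theorem interpolation_imp_K_monotone:
  assumes CM: "exact_calderon_mityagin_positive leq X"
    and sigma: "sigma_dedekind_complete leq X0" "sigma_dedekind_complete leq X1"
    and ideals: "order_ideal leq V X0" "order_ideal leq V X1"
    and diagonal: "\<And>P Q T1 T2.
      \<lbrakk>P \<in> positive_couple_ops leq X leq X; principal_band_projection leq V P;
       Q \<in> positive_couple_ops leq X leq X; principal_band_projection leq V Q;
       T1 \<in> positive_couple_ops leq (image_couple P X) leq (image_couple Q X);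
       contraction (image_couple P X) (image_couple Q X) T1;
       T2 \<in> positive_couple_ops leq (image_couple (\<lambda>x. x - P x) X)
                                leq (image_couple (\<lambda>x. x - Q x) X);
       contraction (image_couple (\<lambda>x. x - P x) X) (image_couple (\<lambda>x. x - Q x) X) T2\<rbrakk>
      \<Longrightarrow> contraction X X (\<lambda>x. Q (T1 (P x)) + (T2 (x - P x) - Q (T2 (x - P x))))"
    and E: "exact_interpolation_space_positive leq X E"
  shows "exactly_partially_K_monotone leq X E"
  unfolding exactly_partially_K_monotone_def
proof (intro conjI ballI impI)
  show int: "intermediate_space X E" using E by (simp add: exact_interpolation_space_positive_def)
  fix f g assume fE: "f \<in> points E" and g: "g \<in> V" and dom: "K_dominated leq X g f"
  have f: "f \<in> V" using fE intermediate_spaceD(2)[OF int] by blast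
  obtain P where P: "band_projection leq V (principal_band leq V (pos f)) P" "sub_identity P"
    using principal_band_projection_exists[OF sigma ideals, of "pos f"] f pos_nonneg by auto
  obtain Q where Q: "band_projection leq V (principal_band leq V (pos g)) Q" "sub_identity Q"
    using principal_band_projection_exists[OF sigma ideals, of "pos g"] g pos_nonneg by auto
  note Pf = principal_band_projection_pos[OF P(1) f] and Qg = principal_band_projection_pos[OF Q(1) g]
  note P' = sub_identity_complement[OF P(2)] and Q' = sub_identity_complement[OF Q(2)]
  have transport: "\<exists>R. positive_contraction R \<and> R u = v"
    if "u \<in> V" "v \<in> V" "0 \<preceq> u" "0 \<preceq> v" "\<And>t. t > 0 \<Longrightarrow> K_functional X v t \<le> K_functional X u t" for u v
    using CM that positive_contraction_scaled[where c = 1]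
    unfolding exact_calderon_mityagin_positive_def by fastforce
  obtain R1 where R1: "positive_contraction R1" "R1 (pos f) = pos g"
    using transport[of "pos f" "pos g"] f g dom by (auto simp: K_dominated_def Let_def pos_nonneg)
  obtain R2 where R2: "positive_contraction R2" "R2 (neg f) = neg g"
    using transport[of "neg f" "neg g"] f g dom by (auto simp: K_dominated_def Let_def neg_nonneg)
  \<comment> \<open>The diagonal entries: \<open>Q R1\<close> carries \<open>pos f\<close> to \<open>pos g\<close>, and \<open>(I - Q) R2\<close> carries \<open>neg f\<close> to
    \<open>neg g\<close>.\<close>
  define T1 where "T1 = (\<lambda>x. Q (R1 x))"
  define T2 where "T2 = (\<lambda>x. R2 x - Q (R2 x))"
  define T where "T = (\<lambda>x. Q (T1 (P x)) + (T2 (x - P x) - Q (T2 (x - P x))))"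
  have "contraction X X T"
    unfolding T_def
  proof (rule diagonal)
    show "P \<in> positive_couple_ops leq X leq X" "Q \<in> positive_couple_ops leq X leq X"
      using P Q positive_contraction_sub_identity positive_contraction_imp_positive_couple_ops by auto
    show "principal_band_projection leq V P" "principal_band_projection leq V Q"
      using P Q f g unfolding principal_band_projection_def by (meson pos_closed)+
  qed (unfold T1_def T2_def,
      (rule compression_contraction[OF R1(1) P(2) Q(2)] compression_contraction[OF R2(1) P' Q'])+)
  moreover have "0 \<preceq> T x" if x: "x \<in> V" "0 \<preceq> x" for x
  proof -
    have pc: "S y \<in> V \<and> 0 \<preceq> S y" if "positive_contraction S" "y \<in> V \<and> 0 \<preceq> y" for S y
      using that positive_contraction_closed[OF that(1)] by (simp add: positive_contraction_def)
    note si = pc[OF positive_contraction_sub_identity]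
    have "Q (T1 (P x)) \<in> V \<and> 0 \<preceq> Q (T1 (P x))"
      unfolding T1_def using si[OF Q(2)] pc[OF R1(1)] si[OF P(2)] x by blast
    moreover have "T2 (x - P x) \<in> V \<and> 0 \<preceq> T2 (x - P x)"
      unfolding T2_def using si[OF Q'] pc[OF R2(1)] si[OF P'] x by blast
    then have "T2 (x - P x) - Q (T2 (x - P x)) \<in> V \<and> 0 \<preceq> T2 (x - P x) - Q (T2 (x - P x))"
      by (rule si[OF Q'])
    ultimately show ?thesis
      unfolding T_def using add_mono[of 0 "Q (T1 (P x))" 0] by simp
  qed
  ultimately have T: "T \<in> positive_couple_ops leq X leq X" "couple_norm X X T \<le> 1"
    by (auto simp: contraction_def positive_couple_ops_def)
  have neg_lin: "S (- y) = - S y" if "linear_op_on V S" "y \<in> V" for S y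
    using that linear_op_on_diff[OF that(1), of 0 y] linear_op_on_diff[OF that(1), of 0 0] by simp
  have "T2 (f - P f) = - neg g"
    using f g neg_lin[of R2 "neg f"] neg_lin[of Q "neg g"] R2 Q(2) Qg
    by (simp add: T2_def Pf neg_of_diff_pos positive_contraction_def sub_identity_def)
  moreover have "T1 (P f) = pos g" by (simp add: T1_def Pf R1 Qg)
  ultimately have "T f = g"
    using neg_lin[of Q "neg g"] Q(2) g
    by (simp add: T_def Qg sub_identity_def pos_minus_neg)
  then show "g \<in> points E" "nrm E g \<le> nrm E f"
    using exact_interpolation_contraction[OF E T fE] by auto
qed

end

lemma lattice_couple_of_compatible:
  assumes "compatible_lattice_couple leq X"
  shows "lattice_couple leq X"
proof -
  interpret riesz_space leq "points (sum_space X)"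
    using assms by unfold_locales (simp add: compatible_lattice_couple_def banach_lattice_def)
  show ?thesis
    using assms
    by unfold_locales (auto simp: compatible_lattice_couple_def intro: banach_lattice_order_ideal)
qed

theorem theorem3p3:
  fixes leq :: "'a::hausdorff_tvs \<Rightarrow> 'a \<Rightarrow> bool" and X :: "'a couple"
  assumes "compatible_lattice_couple leq X"
  shows
    "(\<forall>E. exactly_partially_K_monotone leq X E \<longrightarrow> exact_interpolation_space_positive leq X E) \<and>
     (exact_calderon_mityagin_positive leq X \<and>
      sigma_dedekind_complete leq (points (cpl0 X)) \<and>
      sigma_dedekind_complete leq (points (cpl1 X)) \<and>
      (\<forall>P Q T1 T2.
         P \<in> positive_couple_ops leq X leq X \<and>
         principal_band_projection leq (points (sum_space X)) P \<and>
         Q \<in> positive_couple_ops leq X leq X \<and>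
         principal_band_projection leq (points (sum_space X)) Q \<and>
         T1 \<in> positive_couple_ops leq (image_couple P X) leq (image_couple Q X) \<and>
         contraction (image_couple P X) (image_couple Q X) T1 \<and>
         T2 \<in> positive_couple_ops leq (image_couple (\<lambda>x. x - P x) X)
                                  leq (image_couple (\<lambda>x. x - Q x) X) \<and>
         contraction (image_couple (\<lambda>x. x - P x) X) (image_couple (\<lambda>x. x - Q x) X) T2 \<longrightarrow>
         contraction X X (\<lambda>x. Q (T1 (P x)) + (T2 (x - P x) - Q (T2 (x - P x))))) \<longrightarrow>
      (\<forall>E. exact_interpolation_space_positive leq X E \<longrightarrow> exactly_partially_K_monotone leq X E))"
proof -
  interpret lattice_couple leq X
    using assms by (rule lattice_couple_of_compatible)
  have ideals: "order_ideal leq V X0" "order_ideal leq V X1"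
    using assms by (auto simp: compatible_lattice_couple_def)
  show ?thesis
    using K_monotone_imp_interpolation interpolation_imp_K_monotone[OF _ _ _ ideals]
    by blast
qed

end
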